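(* Let $f_\mu=\ell_2+o(\sqrt{\ell_2})$ pp and $f_\sigma=\sqrt{\ell_2}+o(\sqrt{\ell_2})$ pp be arithmetic functions ("local adjustment functions"). Let $g$ be a real-valued function whose domain contains $[1-\delta,1+\delta]$ for some $\delta>0$, differentiable at $1$ with $g'(1)\ne0$. Then $$\frac{g(\omega/f_\mu)-g(1)}{g'(1)f_\sigma/f_\mu}\Rightarrow\Phi.$$
   Context: For a positive integer $m$, $\omega(m)$ is the number of distinct prime divisors of $m$. $\ell_2(m)=\log\log m$ for $m\ge3$. $\Phi$ is the standard normal distribution function. $\mathbb{P}_n$ is the uniform probability measure on $\{1,\dots,n\}$. Convergence: for functions $h$ defined on sets $\mathbb{M}_n\subseteq\{1,\dots,n\}$ (for $n$ large) with $\mathbb{P}_n(\mathbb{M}_n)\to1$, $h\Rightarrow\Phi$ means $\mathbb{P}_n(\{m\in\mathbb{M}_n:h(m)\le x\})\to\Phi(x)$ for all $x\in\mathbb{R}$. Similarly, $h\Rightarrow c$ means $\mathbb{P}_n(\{m\in\mathbb{M}_n:|h(m)-c|\le\varepsilon\})\to1$ for every $\varepsilon>0$. Domains are the sets where the expressions are defined; any such choice with $\mathbb{P}_n(\mathbb{M}_n)\to1$ gives the same notion. Little-o notation: for arithmetic functions $\tilde g,\tilde f$ defined on such domains, $\tilde g=o(\tilde f)$ pp means $\tilde g/\tilde f\Rightarrow0$. Also $F=H+o(K)$ pp means $F-H=o(K)$ pp. *)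

theory Defs
  imports "HOL-Probability.Probability" "HOL-Computational_Algebra.Primes"
begin

definition omega :: "nat \<Rightarrow> nat" where
  "omega m = card (prime_factors m)"

text \<open>Only meaningful for \<open>m \<ge> 3\<close>; uses restrict the domain accordingly.\<close>
definition ell2 :: "nat \<Rightarrow> real" where
  "ell2 m = ln (ln (real m))"

text \<open>The uniform measure on \<open>{1..n}\<close>. Junk for \<open>n = 0\<close>, which does not affect limits.\<close>
abbreviation unif_prob :: "nat \<Rightarrow> nat set \<Rightarrow> real" where
  "unif_prob n A \<equiv> measure_pmf.prob (pmf_of_set {1..n}) A"

text \<open>A partially defined arithmetic function is given by a total function \<open>h\<close> together with
  a family of domains \<open>M n \<subseteq> {1..n}\<close> (for large \<open>n\<close>) of asymptotically full measure; the values
  of \<open>h\<close> outside the domains are irrelevant.\<close>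
definition full_domains :: "(nat \<Rightarrow> nat set) \<Rightarrow> bool" where
  "full_domains M \<longleftrightarrow>
     (\<forall>\<^sub>F n in sequentially. M n \<subseteq> {1..n}) \<and> (\<lambda>n. unif_prob n (M n)) \<longlonglongrightarrow> 1"

definition conv_std_normal :: "(nat \<Rightarrow> nat set) \<Rightarrow> (nat \<Rightarrow> real) \<Rightarrow> bool" where
  "conv_std_normal M h \<longleftrightarrow> full_domains M \<and>
     (\<forall>x. (\<lambda>n. unif_prob n {m \<in> M n. h m \<le> x}) \<longlonglongrightarrow> cdf std_normal_distribution x)"

definition conv_const :: "(nat \<Rightarrow> nat set) \<Rightarrow> (nat \<Rightarrow> real) \<Rightarrow> real \<Rightarrow> bool" where
  "conv_const M h c \<longleftrightarrow> full_domains M \<and>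
     (\<forall>\<epsilon>>0. (\<lambda>n. unif_prob n {m \<in> M n. \<bar>h m - c\<bar> \<le> \<epsilon>}) \<longlonglongrightarrow> 1)"

text \<open>\<open>g = o(f)\<close> pp, for \<open>g\<close> and \<open>f\<close> both defined on \<open>M\<close>. Division is total in HOL, so the zeros
  of \<open>f\<close> are removed from the domain of the quotient explicitly.\<close>
definition little_o_pp :: "(nat \<Rightarrow> nat set) \<Rightarrow> (nat \<Rightarrow> real) \<Rightarrow> (nat \<Rightarrow> real) \<Rightarrow> bool" where
  "little_o_pp M g f \<longleftrightarrow> conv_const (\<lambda>n. {m \<in> M n. f m \<noteq> 0}) (\<lambda>m. g m / f m) 0"

end

theory Submission
  imports Defs "HOL-Number_Theory.Prime_Powers" "HOL-Real_Asymp.Real_Asymp"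
begin

text \<open>
  The core is the Erdos--Kac theorem, proved with characteristic functions. Let
  \<open>L = ln (ln n)\<close>, and count only the prime divisors \<open>p \<le> exp (ln n / L)\<close>; the omitted ones number
  \<open>O(ln L) = o(sqrt L)\<close> on average. With \<open>z = exp (\<i> t / sqrt L) - 1\<close> the mean of
  \<open>(1 + z)\<close> to the number of small prime divisors expands into a sum over squarefree \<open>d\<close>, whose main
  term is the Euler product of \<open>1 + z / p\<close>. The rounding errors for \<open>d \<le> n\<close> contribute at most
  \<open>1 / n + \<bar>z\<bar>\<close>, because \<open>z\<close> itself tends to 0, and Rankin's trick handles \<open>d > n\<close>. By Mertens'
  second theorem the centered Euler product tends to \<open>exp (- t\<^sup>2 / 2)\<close>, and Levy's theorem applies.

  With \<open>H\<close> the difference quotient of \<open>g\<close> at 1 divided by \<open>g'(1)\<close>, the statistic of the theorem equals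
  \<open>H (\<omega> / f\<^sub>\<mu>) * (\<omega> - f\<^sub>\<mu>) / f\<^sub>\<sigma>\<close>, which differs from \<open>(\<omega> - L) / sqrt L\<close> by a quantity tending to 0
  in probability, so Slutsky's argument finishes the proof.
\<close>

subsection \<open>Mertens' theorems\<close>

text \<open>Distinct primes are coprime, so divisibility by each of them amounts to divisibility by
  their squarefree product.\<close>

lemma prod_primes_dvd_iff:
  fixes A :: "nat set"
  assumes "finite A" "\<And>p. p \<in> A \<Longrightarrow> prime p"
  shows "\<Prod>A dvd m \<longleftrightarrow> (\<forall>p\<in>A. p dvd m)"
  using assms
proof (induction A rule: finite_induct)
  case (insert p A)
  have "coprime p (\<Prod>A)"
    using insert by (intro prod_coprime_right) (auto intro: primes_coprime)
  then have "p * \<Prod>A dvd m \<longleftrightarrow> p dvd m \<and> \<Prod>A dvd m"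
    by (auto intro: divides_mult dvd_mult_left dvd_mult_right)
  with insert show ?case by simp
qed simp

lemma card_dvd_atLeastAtMost: "card {m \<in> {1..n}. d dvd m} = n div (d::nat)" if "d > 0"
proof -
  have "{m \<in> {1..n}. d dvd m} = (\<lambda>k. d * k) ` {1..n div d}"
    using that by (auto simp: image_iff dvd_def less_eq_div_iff_mult_less_eq mult.commute Suc_le_eq)
  also have "card \<dots> = n div d"
    using that by (subst card_image) (auto simp: inj_on_def)
  finally show ?thesis .
qed

lemma real_div_le: "real (n div d) \<le> real n / real d"
proof (cases "d = 0")
  case False
  have "real d * real (n div d) \<le> real n"
    by (metis of_nat_le_iff of_nat_mult times_div_less_eq_dividend)
  then show ?thesis using False by (simp add: field_simps)
qed simp

lemma real_div_le_div_add_one: "real n / real d \<le> real (n div d) + 1" if "d > 0"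
proof -
  have "n \<le> d * (n div d + 1)"
    using that dividend_less_times_div[of d n] by (simp add: mult.commute)
  then have "real n \<le> real d * (real (n div d) + 1)"
    by (metis of_nat_1 of_nat_add of_nat_le_iff of_nat_mult)
  then show ?thesis using that by (simp add: field_simps)
qed

section \<open>Chebyshev's upper bound for \<open>theta\<close>\<close>

definition theta :: "nat \<Rightarrow> real" where
  "theta n = (\<Sum>p | prime p \<and> p \<le> n. ln (real p))"

lemma finite_primes_le [simp]: "finite {p::nat. prime p \<and> p \<le> n}"
  by (rule finite_subset[of _ "{..n}"]) auto

text \<open>Such a prime divides \<open>fact n\<close> but neither factorial in the denominator of
  \<open>n choose (n div 2)\<close>. Hence the product of all of them divides this binomial
  coefficient, which is at most \<open>2 ^ n\<close>. The range starts at
  \<open>n - n div 2\<close>, the larger of the two parts, so that \<open>p\<close> exceeds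
  both.\<close>

lemma sum_ln_prime_half_le:
  fixes n :: nat
  shows "(\<Sum>p | prime p \<and> n - n div 2 < p \<and> p \<le> n. ln (real p)) \<le> real n * ln 2"
proof -
  define A where "A = {p. prime p \<and> n - n div 2 < p \<and> p \<le> n}"
  have fin: "finite A" unfolding A_def by (rule finite_subset[of _ "{..n}"]) auto
  have dvd: "p dvd n choose (n div 2)" if "p \<in> A" for p
  proof -
    have p: "prime p" "n - n div 2 < p" "p \<le> n" using that by (auto simp: A_def)
    have "fact (n div 2) * fact (n - n div 2) * (n choose (n div 2)) = (fact n :: nat)"
      by (rule binomial_fact_lemma) simp
    moreover have "p dvd fact n" using p by (simp add: prime_dvd_fact_iff)
    moreover have "\<not> p dvd fact (n div 2)" "\<not> p dvd fact (n - n div 2)"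
      using p by (auto simp: prime_dvd_fact_iff)
    ultimately show ?thesis using p(1) by (metis prime_dvd_mult_iff)
  qed
  then have "\<Prod>A dvd n choose (n div 2)"
    using fin by (subst prod_primes_dvd_iff) (auto simp: A_def)
  then have "\<Prod>A \<le> n choose (n div 2)" by (rule dvd_imp_le) simp
  also have "\<dots> \<le> 2 ^ n" by (rule binomial_le_pow2)
  finally have "real (\<Prod>A) \<le> 2 ^ n" by (metis of_nat_le_iff of_nat_numeral of_nat_power)
  moreover have "real (\<Prod>A) > 0" by (auto simp: A_def prime_gt_0_nat intro!: prod_pos)
  ultimately have "ln (real (\<Prod>A)) \<le> ln (2 ^ n)" by (subst ln_le_cancel_iff) auto
  also have "\<dots> = real n * ln 2" by (simp add: ln_realpow)
  also have "ln (real (\<Prod>A)) = (\<Sum>p\<in>A. ln (real p))"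
    unfolding of_nat_prod using fin
    by (subst ln_prod) (auto simp: A_def prime_gt_0_nat)
  finally show ?thesis unfolding A_def .
qed

lemma theta_le: "theta n \<le> 4 * ln 2 * real n"
proof (induction n rule: less_induct)
  case (less n)
  show ?case
  proof (cases "n \<ge> 2")
    case False
    then have "{p. prime p \<and> p \<le> n} = {}" by (auto dest: prime_ge_2_nat)
    then show ?thesis unfolding theta_def by (simp only: sum.empty) simp
  next
    case True
    define k where "k = n - n div 2"
    have k: "k < n" "2 * k \<le> n + 1" using True by (auto simp: k_def)
    have "theta n = theta k + (\<Sum>p | prime p \<and> k < p \<and> p \<le> n. ln (real p))"
      unfolding theta_def using k
      by (subst sum.union_disjoint[symmetric]) (auto intro!: sum.cong finite_subset[of _ "{..n}"])
    also have "\<dots> \<le> 4 * ln 2 * real k + real n * ln 2"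
      using less.IH[OF k(1)] sum_ln_prime_half_le[of n] by (simp add: k_def)
    also have "\<dots> = ln 2 * (4 * real k + real n)" by (simp add: algebra_simps)
    \<comment> \<open>From \<open>2 * k \<le> n + 1\<close> the bracket is at most
      \<open>3 * n + 2\<close>, and \<open>n \<ge> 2\<close> makes this at most
      \<open>4 * n\<close>. The constant 4 absorbs the rounding in the halving.\<close>
    also have "\<dots> \<le> ln 2 * (4 * real n)" using k True by (intro mult_left_mono) auto
    finally show ?thesis by simp
  qed
qed

text \<open>Legendre's formula in logarithmic form: \<open>ln m\<close> is the sum of
  \<open>mangoldt\<close> over the divisors of \<open>m\<close>, and after exchanging the sums each
  \<open>d\<close> is counted once per multiple up to \<open>n\<close>.\<close>

lemma ln_fact_eq_sum_mangoldt:
  "ln (fact n) = (\<Sum>d=1..n. mangoldt d * real (n div d))"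
proof -
  have "ln (fact n :: real) = (\<Sum>m=1..n. ln (real m))"
    unfolding fact_prod of_nat_prod by (subst ln_prod) auto
  also have "\<dots> = (\<Sum>m=1..n. \<Sum>d | d dvd m. mangoldt d)"
    by (intro sum.cong refl) (subst mangoldt_sum, auto)
  also have "\<dots> = (\<Sum>m=1..n. \<Sum>d=1..n. if d dvd m then mangoldt d else 0)"
  proof (rule sum.cong[OF refl])
    fix m assume "m \<in> {1..n}"
    then have "{d. d dvd m} = {d \<in> {1..n}. d dvd m}"
      by (auto dest: dvd_imp_le simp: Suc_le_eq intro: Nat.gr0I)
    then show "(\<Sum>d | d dvd m. mangoldt d) = (\<Sum>d=1..n. if d dvd m then mangoldt d else (0::real))"
      by (simp only: sum.inter_filter finite_atLeastAtMost)
  qed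
  also have "\<dots> = (\<Sum>d=1..n. \<Sum>m=1..n. if d dvd m then mangoldt d else 0)"
    by (rule sum.swap)
  also have "\<dots> = (\<Sum>d=1..n. mangoldt d * real (n div d))"
    using card_dvd_atLeastAtMost
    by (intro sum.cong refl) (simp add: sum.If_cases Int_def mult.commute)
  finally show ?thesis .
qed

text \<open>A weak Stirling bound: \<open>n ^ n / fact n\<close> is a single term of the exponential
  series at \<open>n\<close>, hence at most \<open>exp n\<close>.\<close>

lemma ln_fact_ge: "n * ln n - n \<le> ln (fact n)"
proof (cases "n = 0")
  case False
  have "real n ^ n / fact n \<le> exp (real n)"
    using sum_le_suminf[OF summable_exp, of "{n}" "real n"]
    by (simp add: exp_def field_simps)
  then have "ln (real n ^ n / fact n) \<le> real n"
    using False by (metis exp_gt_zero fact_gt_zero ln_exp ln_mono of_nat_0_less_iff not_gr0 zero_less_divide_iff zero_less_power)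
  then show ?thesis using False by (simp add: ln_div ln_realpow)
qed simp


section \<open>Mertens' first theorem\<close>

definition sum_ln_over_primes :: "nat \<Rightarrow> real" where
  "sum_ln_over_primes n = (\<Sum>p | prime p \<and> p \<le> n. ln (real p) / real p)"

definition sum_inverse_primes :: "nat \<Rightarrow> real" where
  "sum_inverse_primes n = (\<Sum>p | prime p \<and> p \<le> n. 1 / real p)"

text \<open>In Legendre's formula only the primes are kept, the other terms being nonnegative.
  Replacing \<open>n / p\<close> by \<open>n div p\<close> costs at most \<open>ln p\<close> per
  prime, altogether \<open>theta n\<close>, which is linear in \<open>n\<close> by Chebyshev's
  bound.\<close>

lemma sum_ln_over_primes_le:
  assumes "n \<ge> 1"
  shows "sum_ln_over_primes n \<le> ln (real n) + 4 * ln 2"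
proof -
  let ?P = "{p. prime p \<and> p \<le> n}"
  have "real n * sum_ln_over_primes n = (\<Sum>p\<in>?P. ln (real p) * (real n / real p))"
    unfolding sum_ln_over_primes_def sum_distrib_left by (intro sum.cong) auto
  also have "\<dots> \<le> (\<Sum>p\<in>?P. ln (real p) * (real (n div p) + 1))"
  proof (intro sum_mono mult_left_mono)
    fix p assume "p \<in> ?P"
    then have "p > 0" by (auto simp: prime_gt_0_nat)
    then show "real n / real p \<le> real (n div p) + 1"
      by (rule real_div_le_div_add_one)
  qed (auto simp: prime_gt_0_nat Suc_le_eq)
  also have "\<dots> = (\<Sum>p\<in>?P. mangoldt p * real (n div p)) + theta n"
    unfolding theta_def sum.distrib[symmetric] by (intro sum.cong) (auto simp: algebra_simps)
  also have "(\<Sum>p\<in>?P. mangoldt p * real (n div p)) \<le> (\<Sum>d=1..n. mangoldt d * real (n div d))"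
    by (intro sum_mono2) (auto simp: mangoldt_nonneg prime_gt_0_nat Suc_le_eq)
  also have "\<dots> = ln (fact n)" by (rule ln_fact_eq_sum_mangoldt[symmetric])
  also have "\<dots> \<le> ln (real n ^ n)"
    using fact_le_power[of n, where 'a = real] assms by (subst ln_le_cancel_iff) auto
  also have "\<dots> = real n * ln (real n)" using assms by (simp add: ln_realpow)
  also note theta_le[of n]
  finally have "real n * sum_ln_over_primes n \<le> real n * (ln (real n) + 4 * ln 2)"
    by (simp add: algebra_simps)
  then show ?thesis using assms by (simp add: mult_le_cancel_left_pos)
qed

text \<open>Used with \<open>x = 1 / p\<close>: the proper powers of a prime contribute only
  quadratically. The induction splits off the first term, and the bound reproduces itself because
  \<open>1 + 2 * x \<le> 2\<close>.\<close>

lemma sum_power_Suc_le: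
  fixes x :: real
  assumes "0 \<le> x" "x \<le> 1/2"
  shows "(\<Sum>k<n. x ^ Suc k) \<le> x + 2 * x\<^sup>2"
proof (induction n)
  case (Suc n)
  have "(\<Sum>k<Suc n. x ^ Suc k) = x + x * (\<Sum>k<n. x ^ Suc k)"
    by (subst sum.lessThan_Suc_shift) (simp add: sum_distrib_left)
  also have "\<dots> \<le> x + x * (x + 2 * x\<^sup>2)" using Suc assms by (intro add_left_mono mult_left_mono)
  also have "\<dots> = x + x\<^sup>2 * (1 + 2 * x)" by (simp add: algebra_simps power2_eq_square)
  also have "\<dots> \<le> x + x\<^sup>2 * 2" using assms by (intro add_left_mono mult_left_mono) auto
  finally show ?case by simp
qed (use assms in auto)

lemma summable_ln_over_square: "summable (\<lambda>k. ln (real k) / real k ^ 2)"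
proof (rule summable_comparison_test_bigo)
  show "summable (\<lambda>k. norm (real k powr (-3/2)))"
    by (simp add: summable_real_powr_iff)
  show "(\<lambda>k. ln (real k) / real k ^ 2) \<in> O(\<lambda>k. real k powr (-3/2))"
    by real_asymp
qed

text \<open>Legendre's formula again, now with all prime powers. The proper powers of
  \<open>p\<close> add at most \<open>2 * ln p / p ^ 2\<close>, which is summable, so the primes
  alone account for \<open>ln n\<close> up to a constant.\<close>

lemma sum_ln_over_primes_ge:
  assumes "n \<ge> 1"
  shows "ln (real n) - 1 - 2 * (\<Sum>k. ln (real k) / real k ^ 2) \<le> sum_ln_over_primes n"
proof -
  let ?P = "{p. prime p \<and> p \<le> n}"
  let ?B = "\<Sum>k. ln (real k) / real k ^ 2"
  have "real n * ln (real n) - real n \<le> (\<Sum>d=1..n. mangoldt d * real (n div d))"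
    using ln_fact_ge[of n] ln_fact_eq_sum_mangoldt[of n] by simp
  also have "\<dots> \<le> (\<Sum>d=1..n. mangoldt d * (real n / real d))"
    by (intro sum_mono mult_left_mono mangoldt_nonneg real_div_le)
  also have "\<dots> = real n * (\<Sum>d=1..n. mangoldt d / real d)"
    unfolding sum_distrib_left by (intro sum.cong) auto
  finally have "real n * (ln (real n) - 1) \<le> real n * (\<Sum>d=1..n. mangoldt d / real d)"
    by (simp add: algebra_simps)
  then have "ln (real n) - 1 \<le> (\<Sum>d=1..n. mangoldt d / real d)"
    using assms by (simp add: mult_le_cancel_left_pos)
  also have "\<dots> = (\<Sum>d\<in>{d\<in>{1..n}. primepow d}. mangoldt d / real d)"
    by (intro sum.mono_neutral_right) (auto simp: mangoldt_def)
  \<comment> \<open>The prime powers up to \<open>n\<close> are covered by the exponents 1 to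
    \<open>n\<close> of the primes up to \<open>n\<close>. Surplus terms only enlarge the sum since
    \<open>mangoldt\<close> is nonnegative; for the same reason the passage from the image to pairs
    is an inequality.\<close>
  also have "\<dots> \<le> (\<Sum>d\<in>(\<lambda>(p,k). p ^ Suc k) ` (?P \<times> {..<n}). mangoldt d / real d)"
  proof (rule sum_mono2)
    show "{d\<in>{1..n}. primepow d} \<subseteq> (\<lambda>(p,k). p ^ Suc k) ` (?P \<times> {..<n})"
    proof
      fix d assume "d \<in> {d\<in>{1..n}. primepow d}"
      then obtain p k where pk: "prime p" "k > 0" "d = p ^ k" "d \<le> n"
        by (auto simp: primepow_def)
      have "k < p ^ k" using pk prime_ge_2_nat
        by (metis One_nat_def Suc_le_lessD numeral_2_eq_2 power_gt_expt)
      moreover have "p \<le> p ^ k" using pk by (intro self_le_power) (auto simp: prime_gt_0_nat Suc_le_eq)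
      ultimately have "(p, k - 1) \<in> ?P \<times> {..<n}" "d = p ^ Suc (k - 1)" using pk by auto
      then show "d \<in> (\<lambda>(p,k). p ^ Suc k) ` (?P \<times> {..<n})"
        by (intro image_eqI[of _ _ "(p, k - 1)"]) auto
    qed
  qed (auto simp: mangoldt_nonneg)
  also have "\<dots> \<le> (\<Sum>(p,k)\<in>?P \<times> {..<n}. mangoldt (p ^ Suc k) / real (p ^ Suc k))"
    using sum_image_le[of "?P \<times> {..<n}" "\<lambda>d. mangoldt d / real d" "\<lambda>(p,k). p ^ Suc k"]
    by (auto simp: mangoldt_nonneg o_def case_prod_unfold)
  also have "\<dots> = (\<Sum>(p,k)\<in>?P \<times> {..<n}. ln (real p) * (1 / real p) ^ Suc k)"
    by (intro sum.cong refl) (auto simp: power_one_over simp del: power_Suc)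
  also have "\<dots> = (\<Sum>p\<in>?P. ln (real p) * (\<Sum>k<n. (1 / real p) ^ Suc k))"
    by (subst sum.cartesian_product[symmetric]) (simp add: sum_distrib_left)
  also have "\<dots> \<le> (\<Sum>p\<in>?P. ln (real p) * (1 / real p + 2 * (1 / real p) ^ 2))"
  proof (intro sum_mono mult_left_mono)
    fix p assume "p \<in> ?P"
    then have "p \<ge> 2" by (auto dest: prime_ge_2_nat)
    then show "(\<Sum>k<n. (1 / real p) ^ Suc k) \<le> 1 / real p + 2 * (1 / real p) ^ 2"
      by (intro sum_power_Suc_le) (auto simp: field_simps)
  qed (auto simp: prime_gt_0_nat Suc_le_eq)
  also have "\<dots> = sum_ln_over_primes n + 2 * (\<Sum>p\<in>?P. ln (real p) / real p ^ 2)"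
    unfolding sum_ln_over_primes_def sum_distrib_left sum.distrib[symmetric]
    by (intro sum.cong) (auto simp: field_simps power2_eq_square)
  also have "(\<Sum>p\<in>?P. ln (real p) / real p ^ 2) \<le> ?B"
  proof (intro sum_le_suminf summable_ln_over_square)
    show "0 \<le> ln (real k) / real k ^ 2" for k by (cases "k = 0") auto
  qed auto
  finally show ?thesis by simp
qed

section \<open>Mertens' second theorem by partial summation\<close>

lemma sum_primes_Suc:
  fixes f :: "nat \<Rightarrow> real"
  shows "(\<Sum>p | prime p \<and> p \<le> Suc n. f p) = (\<Sum>p | prime p \<and> p \<le> n. f p) + (if prime (Suc n) then f (Suc n) else 0)"
proof -
  have "{p. prime p \<and> p \<le> Suc n} = {p. prime p \<and> p \<le> n} \<union> (if prime (Suc n) then {Suc n} else {})"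
    by (auto simp: le_Suc_eq)
  then show ?thesis by (simp add: sum.union_disjoint)
qed

lemma ln_diff_bounds:
  fixes a b :: real
  assumes "0 < a" "a \<le> b"
  shows "(b - a) / b \<le> ln b - ln a" "ln b - ln a \<le> (b - a) / a"
  using ln_diff_le[of b a] ln_diff_le[of a b] assms by (auto simp: field_simps)

text \<open>Partial summation in difference form. The increments of \<open>D\<close> are dominated
  by those of \<open>- (C + 1) / ln n\<close>, which telescope, so \<open>D\<close> is bounded; the
  quotient \<open>?A n / ln n\<close> inside \<open>D\<close> is bounded by Mertens' first
  theorem.\<close>

theorem mertens_second:
  obtains C where "C \<ge> 0" "\<And>n. n \<ge> 2 \<Longrightarrow> \<bar>sum_inverse_primes n - ln (ln (real n))\<bar> \<le> C"
proof -
  let ?S = sum_inverse_primes and ?A = sum_ln_over_primes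
  obtain C where C: "C \<ge> 0" "\<And>n. n \<ge> 1 \<Longrightarrow> \<bar>?A n - ln (real n)\<bar> \<le> C"
  proof
    let ?B = "\<Sum>k. ln (real k) / real k ^ 2"
    show "\<bar>?A n - ln (real n)\<bar> \<le> \<bar>4 * ln 2\<bar> + \<bar>1 + 2 * ?B\<bar>" if "n \<ge> 1" for n
      using sum_ln_over_primes_le[OF that] sum_ln_over_primes_ge[OF that] by linarith
  qed auto
  define D where "D n = ?S n - ?A n / ln (real n) - ln (ln (real n))" for n
  have step: "\<bar>D (Suc n) - D n\<bar> \<le> (C + 1) * (1 / ln (real n) - 1 / ln (real (Suc n)))"
    if n: "n \<ge> 2" for n
  proof -
    define a b where "a = ln (real n)" and "b = ln (real (Suc n))"
    have ab: "0 < a" "a < b" using n by (auto simp: a_def b_def)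
    have "b - a \<le> (real (Suc n) - real n) / real n"
      unfolding a_def b_def using n by (intro ln_diff_bounds) auto
    also have "\<dots> \<le> 1" using n by simp
    finally have ba: "b - a \<le> 1" .
    define r where "r = ?A n - a"
    have r: "\<bar>r\<bar> \<le> C" using C(2)[of n] n by (simp add: r_def a_def)
    \<comment> \<open>Both sums change only if \<open>Suc n\<close> is prime, and then the two new
      terms differ by the factor \<open>ln (Suc n) = b\<close>.\<close>
    have "?S (Suc n) - ?S n = (?A (Suc n) - ?A n) / b"
      unfolding sum_inverse_primes_def sum_ln_over_primes_def sum_primes_Suc
      using ab by (auto simp: b_def)
    then have "D (Suc n) - D n = ?A n * (1 / a - 1 / b) - (ln b - ln a)"
      by (simp add: D_def a_def b_def algebra_simps diff_divide_distrib)
    \<comment> \<open>The main part \<open>a\<close> of \<open>?A n\<close> yields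
      \<open>(b - a) / b\<close>, which nearly cancels the increment \<open>ln b - ln a\<close> of
      the iterated logarithm.\<close>
    also have "?A n * (1 / a - 1 / b) = r * (1 / a - 1 / b) + (b - a) / b"
      using ab by (simp add: r_def field_simps)
    finally have eq: "D (Suc n) - D n = r * (1 / a - 1 / b) + ((b - a) / b - (ln b - ln a))" by simp
    have nn: "0 \<le> 1 / a - 1 / b" using ab by (simp add: field_simps)
    \<comment> \<open>Both \<open>(b - a) / b\<close> and \<open>ln b - ln a\<close> lie between
      \<open>(b - a) / b\<close> and \<open>(b - a) / a\<close>. The length of this interval is at
      most \<open>1 / a - 1 / b\<close> because \<open>b - a \<le> 1\<close>.\<close>
    have "(b - a) / a - (b - a) / b = (b - a) * (1 / a - 1 / b)" by (simp add: algebra_simps)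
    also have "\<dots> \<le> 1 * (1 / a - 1 / b)" using ba nn by (intro mult_right_mono)
    finally have "(b - a) / a - (b - a) / b \<le> 1 * (1 / a - 1 / b)" .
    moreover have "\<bar>u - v\<bar> \<le> w" if "u' - u \<le> 1 * w" "u \<le> v" "v \<le> u'" for u v u' w :: real
      using that by linarith
    ultimately have "\<bar>(b - a) / b - (ln b - ln a)\<bar> \<le> 1 / a - 1 / b"
      using ln_diff_bounds[OF ab(1) less_imp_le[OF ab(2)]] by blast
    moreover have "\<bar>r * (1 / a - 1 / b)\<bar> \<le> C * (1 / a - 1 / b)"
      unfolding abs_mult abs_of_nonneg[OF nn] using r nn by (rule mult_right_mono)
    ultimately have "\<bar>D (Suc n) - D n\<bar> \<le> C * (1 / a - 1 / b) + (1 / a - 1 / b)"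
      unfolding eq by (intro order.trans[OF abs_triangle_ineq] add_mono)
    then show ?thesis
      unfolding a_def[symmetric] b_def[symmetric] by (simp only: distrib_right mult_1)
  qed
  have D: "\<bar>D n\<bar> \<le> \<bar>D 2\<bar> + (C + 1) * (1 / ln 2 - 1 / ln (real n))" if "n \<ge> 2" for n
    using that
  proof (induction n rule: dec_induct)
    case (step n)
    then show ?case using step(1) \<open>\<And>n. n \<ge> 2 \<Longrightarrow> \<bar>D (Suc n) - D n\<bar> \<le> _ n\<close>[of n]
      by (simp add: algebra_simps)
  qed simp
  show ?thesis
  proof
    let ?K = "\<bar>D 2\<bar> + (C + 1) * (1 / ln 2) + (1 + C / ln 2)"
    show "0 \<le> ?K" using C(1) by simp
    show "\<bar>?S n - ln (ln (real n))\<bar> \<le> ?K" if n: "n \<ge> 2" for n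
    proof -
      have ln2: "ln 2 \<le> ln (real n)" "0 < ln (real n)" using n by auto
      have "\<bar>?A n / ln (real n)\<bar> \<le> (ln (real n) + C) / ln (real n)"
        unfolding abs_divide abs_of_pos[OF ln2(2)]
        using C(2)[of n] n ln2 by (intro divide_right_mono) linarith+
      also have "\<dots> = 1 + C / ln (real n)" using ln2 by (simp add: field_simps)
      also have "\<dots> \<le> 1 + C / ln 2" using ln2 C(1) by (intro add_left_mono divide_left_mono) auto
      finally have "\<bar>?A n / ln (real n)\<bar> \<le> 1 + C / ln 2" .
      moreover have "(C + 1) * (1 / ln 2 - 1 / ln (real n)) \<le> (C + 1) * (1 / ln 2)"
        using C(1) ln2 by (intro mult_left_mono) auto
      ultimately show ?thesis using D[OF n] unfolding D_def by linarith
    qed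
  qed
qed

subsection \<open>Means of powers of restricted prime divisor counts\<close>

definition count_dividing :: "nat set \<Rightarrow> nat \<Rightarrow> nat" where
  "count_dividing P m = card {p \<in> P. p dvd m}"

text \<open>Unique factorization recovers a set of primes from its product; this makes the passage
  from sets to squarefree divisors injective.\<close>

lemma prime_factors_prod_primes:
  fixes A :: "nat set"
  assumes "finite A" "\<And>p. p \<in> A \<Longrightarrow> prime p"
  shows "prime_factors (\<Prod>A) = A"
  using assms
proof (induction A rule: finite_induct)
  case (insert p A)
  have "prime p" using insert.prems by simp
  have "0 \<notin> A" using insert.prems[of 0] by auto
  then have "\<Prod>A \<noteq> 0" "p \<noteq> 0" using insert.hyps \<open>prime p\<close> by auto
  with insert \<open>prime p\<close> show ?case
    by (simp add: prime_factors_product prime_factorization_prime)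
qed simp

lemma sum_subset_powers:
  fixes z :: "'a :: comm_ring_1"
  assumes "finite B"
  shows "(1 + z) ^ card B = (\<Sum>A\<in>Pow B. z ^ card A)"
  using prod_add[OF assms, of "\<lambda>_. z" "\<lambda>_. 1"] by (simp add: add.commute)

text \<open>The binomial expansion runs over the sets \<open>A\<close> of primes of \<open>P\<close>
  dividing \<open>m\<close>, and these are the \<open>A\<close> whose product divides
  \<open>m\<close>. Exchanging the sums leaves the number of multiples of \<open>\<Prod>A\<close> up
  to \<open>n\<close>.\<close>

lemma sum_power_count_dividing:
  fixes z :: "'a :: comm_ring_1"
  assumes "finite P" "\<And>p. p \<in> P \<Longrightarrow> prime p"
  shows "(\<Sum>m=1..n. (1 + z) ^ count_dividing P m) = (\<Sum>A\<in>Pow P. z ^ card A * of_nat (n div \<Prod>A))"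
proof -
  have "(\<Sum>m=1..n. (1 + z) ^ count_dividing P m) = (\<Sum>m=1..n. \<Sum>A\<in>Pow {p\<in>P. p dvd m}. z ^ card A)"
    unfolding count_dividing_def using assms(1)
    by (intro sum.cong[OF refl] sum_subset_powers) simp
  also have "\<dots> = (\<Sum>m=1..n. \<Sum>A\<in>Pow P. if \<Prod>A dvd m then z ^ card A else 0)"
  proof (rule sum.cong[OF refl])
    fix m assume "m \<in> {1..n}"
    have "Pow {p\<in>P. p dvd m} = {A \<in> Pow P. \<Prod>A dvd m}"
    proof (intro set_eqI)
      fix A
      show "A \<in> Pow {p\<in>P. p dvd m} \<longleftrightarrow> A \<in> {A \<in> Pow P. \<Prod>A dvd m}"
        using prod_primes_dvd_iff[of A m] finite_subset[of A P] assms
        by (cases "A \<subseteq> P") blast+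
    qed
    then have "(\<Sum>A\<in>Pow {p\<in>P. p dvd m}. z ^ card A) = (\<Sum>A\<in>{A \<in> Pow P. \<Prod>A dvd m}. z ^ card A)"
      by (rule arg_cong)
    also have "\<dots> = (\<Sum>A\<in>Pow P. if \<Prod>A dvd m then z ^ card A else 0)"
      using assms by (intro sum.inter_filter) simp
    finally show "(\<Sum>A\<in>Pow {p\<in>P. p dvd m}. z ^ card A) = (\<Sum>A\<in>Pow P. if \<Prod>A dvd m then z ^ card A else 0)" .
  qed
  also have "\<dots> = (\<Sum>A\<in>Pow P. \<Sum>m=1..n. if \<Prod>A dvd m then z ^ card A else 0)"
    by (rule sum.swap)
  also have "\<dots> = (\<Sum>A\<in>Pow P. z ^ card A * of_nat (n div \<Prod>A))"
  proof (rule sum.cong[OF refl])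
    fix A assume "A \<in> Pow P"
    then have "\<Prod>A > 0" using assms by (intro prod_pos) (auto dest: prime_gt_0_nat)
    then have "card {m \<in> {1..n}. \<Prod>A dvd m} = n div \<Prod>A" by (rule card_dvd_atLeastAtMost)
    then show "(\<Sum>m=1..n. if \<Prod>A dvd m then z ^ card A else 0) = z ^ card A * of_nat (n div \<Prod>A)"
      by (simp add: sum.If_cases Int_def mult.commute)
  qed
  finally show ?thesis .
qed

lemma prod_one_add_over_primes:
  fixes z :: "'a :: field" and P :: "nat set"
  assumes "finite P"
  shows "(\<Prod>p\<in>P. 1 + z / of_nat p) = (\<Sum>A\<in>Pow P. z ^ card A / of_nat (\<Prod>A))"
  using prod_add[OF assms, of "\<lambda>p. z / of_nat p" "\<lambda>_. 1"]
  by (simp add: add.commute prod_dividef)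

text \<open>For \<open>d \<le> n\<close> rounding costs at most 1 before the division by
  \<open>n\<close>. For \<open>d > n\<close> the quotient \<open>n div d\<close> is 0 and the loss
  \<open>1 / d\<close> is multiplied by Rankin's factor \<open>(d / n) powr \<alpha>\<close>, which
  is at least 1.\<close>

lemma abs_div_over_diff_le:
  fixes n d :: nat and \<alpha> :: real
  assumes "n \<ge> 1" "d \<ge> 1" "\<alpha> \<ge> 0"
  shows "\<bar>real (n div d) / n - 1 / d\<bar> \<le> (if d \<le> n then 1 / n else 0) + real n powr (-\<alpha>) * (real d powr \<alpha> / d)"
proof (cases "d \<le> n")
  case True
  have "\<bar>real (n div d) - n / d\<bar> \<le> 1"
    using real_div_le[of n d] real_div_le_div_add_one[of d n] assms by linarith
  then have "\<bar>real (n div d) - n / d\<bar> / n \<le> 1 / n" by (rule divide_right_mono) simp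
  also have "\<bar>real (n div d) - n / d\<bar> / n = \<bar>(real (n div d) - n / d) / n\<bar>" by simp
  also have "(real (n div d) - n / d) / n = real (n div d) / n - 1 / d"
    using assms by (simp add: diff_divide_distrib)
  finally show ?thesis using True by (simp add: add_increasing2)
next
  case False
  then have "1 \<le> (real d / real n) powr \<alpha>"
    using assms by (intro ge_one_powr_ge_zero) auto
  also have "\<dots> = real n powr (-\<alpha>) * real d powr \<alpha>"
    using assms by (simp add: powr_divide powr_minus_divide)
  finally have "1 / real d \<le> real n powr (-\<alpha>) * real d powr \<alpha> / d"
    by (rule divide_right_mono) simp
  moreover have "real (n div d) = 0" using False by simp
  ultimately show ?thesis using False by simp
qed

text \<open>The error terms are summed trivially over the divisors \<open>d \<le> n\<close>, using that \<open>z\<close> is small,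
  and by Rankin's trick over \<open>d > n\<close>.\<close>
lemma mean_power_count_dividing:
  fixes z :: complex and \<alpha> :: real
  assumes P: "finite P" "\<And>p. p \<in> P \<Longrightarrow> prime p"
    and z: "cmod z \<le> 1" and n: "n \<ge> 1"
    and \<alpha>: "\<alpha> \<ge> 0" "\<And>p. p \<in> P \<Longrightarrow> real p powr \<alpha> \<le> exp 1"
  shows "cmod ((\<Sum>m=1..n. (1 + z) ^ count_dividing P m) / n - (\<Prod>p\<in>P. 1 + z / of_nat p))
    \<le> 1 / n + cmod z + real n powr (-\<alpha>) * exp (exp 1 * cmod z * (\<Sum>p\<in>P. 1 / real p))"
proof -
  have pos: "\<Prod>A > 0" if "A \<in> Pow P" for A
    using that P by (intro prod_pos) (auto dest: prime_gt_0_nat)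
  have expand: "(\<Sum>m=1..n. (1 + z) ^ count_dividing P m)
      = (\<Sum>A\<in>Pow P. z ^ card A * of_nat (n div \<Prod>A))"
    by (rule sum_power_count_dividing) (use P in auto)
  \<comment> \<open>\<open>T\<close> holds the sets with divisor at most \<open>n\<close>, those to
    which the error \<open>1 / n\<close> applies. \<open>E A\<close> is the bound of
    \<open>abs_div_over_diff_le\<close> weighted with \<open>cmod z ^ card A\<close>.\<close>
  define T where "T = {A \<in> Pow P. \<Prod>A \<le> n}"
  define E where "E A = (if \<Prod>A \<le> n then cmod z ^ card A / n else 0)
     + real n powr (-\<alpha>) * (cmod z ^ card A * real (\<Prod>A) powr \<alpha> / real (\<Prod>A))" for A
  have fin: "finite T" using P by (simp add: T_def)
  have "(\<Sum>m=1..n. (1 + z) ^ count_dividing P m) / n - (\<Prod>p\<in>P. 1 + z / of_nat p)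
    = (\<Sum>A\<in>Pow P. z ^ card A * (of_nat (n div \<Prod>A) / of_nat n - 1 / of_nat (\<Prod>A)))"
    unfolding expand prod_one_add_over_primes[OF P(1)]
    by (simp only: sum_divide_distrib sum_subtractf right_diff_distrib times_divide_eq_right mult_1_right)
  also have "cmod \<dots> \<le> (\<Sum>A\<in>Pow P. E A)"
  proof (rule sum_norm_le)
    fix A assume A: "A \<in> Pow P"
    define d where "d = \<Prod>A"
    have d: "d > 0" using pos[OF A] by (simp add: d_def)
    have "of_nat (n div d) / of_nat n - 1 / of_nat d = complex_of_real (real (n div d) / n - 1 / d)"
      by (simp only: of_real_diff of_real_divide of_real_of_nat_eq of_real_1)
    then have "cmod (of_nat (n div d) / of_nat n - 1 / of_nat d) = \<bar>real (n div d) / n - 1 / d\<bar>"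
      by (simp only: norm_of_real)
    also have "\<dots> \<le> (if d \<le> n then 1 / n else 0) + real n powr (-\<alpha>) * (real d powr \<alpha> / d)"
      using n d \<alpha>(1) by (intro abs_div_over_diff_le) auto
    finally have "cmod (z ^ card A * (of_nat (n div d) / of_nat n - 1 / of_nat d))
      \<le> cmod z ^ card A * ((if d \<le> n then 1 / n else 0) + real n powr (-\<alpha>) * (real d powr \<alpha> / d))"
      unfolding norm_mult norm_power by (intro mult_left_mono) auto
    also have "\<dots> = E A" by (simp add: E_def d_def algebra_simps)
    finally show "cmod (z ^ card A * (of_nat (n div \<Prod>A) / of_nat n - 1 / of_nat (\<Prod>A))) \<le> E A"
      by (simp only: d_def)
  qed
  also have "\<dots> = (\<Sum>A\<in>T. cmod z ^ card A / n)
     + real n powr (-\<alpha>) * (\<Sum>A\<in>Pow P. cmod z ^ card A * real (\<Prod>A) powr \<alpha> / real (\<Prod>A))"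
    unfolding E_def sum.distrib sum_distrib_left T_def using P(1)
    by (subst sum.inter_filter) simp_all
  finally have main: "cmod ((\<Sum>m=1..n. (1 + z) ^ count_dividing P m) / n - (\<Prod>p\<in>P. 1 + z / of_nat p))
    \<le> (\<Sum>A\<in>T. cmod z ^ card A / n)
     + real n powr (-\<alpha>) * (\<Sum>A\<in>Pow P. cmod z ^ card A * real (\<Prod>A) powr \<alpha> / real (\<Prod>A))" .
  have small: "(\<Sum>A\<in>T. cmod z ^ card A / n) \<le> 1 / n + cmod z"
  proof -
    \<comment> \<open>Distinct sets in \<open>T\<close> have distinct products in
      \<open>{1..n}\<close>, hence \<open>T\<close> has at most \<open>n\<close> elements.\<close>
    have "inj_on \<Prod> T"
    proof (rule inj_onI)
      fix A B assume AB: "A \<in> T" "B \<in> T" "\<Prod>A = \<Prod>B"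
      have "prime_factors (\<Prod>C) = C" if "C \<in> T" for C
        using that P finite_subset[of C P] by (intro prime_factors_prod_primes) (auto simp: T_def)
      then have "prime_factors (\<Prod>A) = A" "prime_factors (\<Prod>B) = B"
        using AB(1,2) by (simp_all only:)
      then show "A = B" using AB(3) by metis
    qed
    moreover have "\<Prod> ` T \<subseteq> {1..n}" using pos by (auto simp: T_def Suc_le_eq)
    ultimately have card: "card T \<le> n" using card_inj_on_le[of \<Prod> T "{1..n}"] by simp
    \<comment> \<open>The empty set contributes \<open>1 / n\<close>. Every other set carries at
      least one factor \<open>cmod z\<close>, and further ones do no harm as
      \<open>cmod z \<le> 1\<close>.\<close>
    have "(\<Sum>A\<in>T. cmod z ^ card A / n) \<le> (\<Sum>A\<in>T. (if A = {} then 1 / n else 0) + cmod z / n)"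
    proof (rule sum_mono)
      fix A assume "A \<in> T"
      show "cmod z ^ card A / n \<le> (if A = {} then 1 / n else 0) + cmod z / n"
      proof (cases "A = {}")
        case False
        have "finite A" using \<open>A \<in> T\<close> P(1) finite_subset[of A P] by (simp add: T_def)
        with False have "card A \<noteq> 0" by simp
        then have "cmod z ^ card A \<le> cmod z ^ 1"
          using z by (intro power_decreasing) auto
        then show ?thesis using False by (simp add: divide_right_mono)
      qed simp
    qed
    also have "\<dots> \<le> 1 / n + real (card T) * (cmod z / n)"
      using fin by (simp add: sum.distrib)
    also have "real (card T) * (cmod z / n) \<le> real n * (cmod z / n)"
      using card by (intro mult_right_mono) auto
    finally show ?thesis using n by simp
  qed
  have "(\<Sum>A\<in>Pow P. cmod z ^ card A * real (\<Prod>A) powr \<alpha> / real (\<Prod>A))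
      = (\<Sum>A\<in>Pow P. \<Prod>p\<in>A. cmod z * real p powr \<alpha> / real p)"
    by (intro sum.cong refl) (simp add: prod_dividef prod.distrib prod_powr_distrib)
  also have "\<dots> = (\<Prod>p\<in>P. 1 + cmod z * real p powr \<alpha> / real p)"
    using prod_add[OF P(1), of "\<lambda>p. cmod z * real p powr \<alpha> / real p" "\<lambda>_. 1"]
    by (simp add: add.commute)
  \<comment> \<open>Rankin's sum has become an Euler product;
    \<open>real p powr \<alpha> \<le> exp 1\<close> and \<open>1 + x \<le> exp x\<close> bound its
    factors.\<close>
  also have "\<dots> \<le> (\<Prod>p\<in>P. exp (exp 1 * cmod z * (1 / real p)))"
  proof (rule prod_mono, rule conjI)
    fix p assume p: "p \<in> P"
    have "1 + cmod z * real p powr \<alpha> / real p \<le> 1 + cmod z * exp 1 / real p"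
      using \<alpha>(2)[OF p] by (intro add_left_mono divide_right_mono mult_left_mono) auto
    also have "\<dots> \<le> exp (exp 1 * cmod z * (1 / real p))"
      using exp_ge_add_one_self[of "exp 1 * cmod z * (1 / real p)"] by (simp add: mult.commute)
    finally show "1 + cmod z * real p powr \<alpha> / real p \<le> exp (exp 1 * cmod z * (1 / real p))" .
  qed simp
  also have "\<dots> = exp (exp 1 * cmod z * (\<Sum>p\<in>P. 1 / real p))"
    using P(1) by (simp only: exp_sum[symmetric] sum_distrib_left)
  finally show ?thesis
    by (intro order.trans[OF main] add_mono[OF small] mult_left_mono powr_ge_zero)
qed

subsection \<open>Asymptotics of the truncated count\<close>

lemma ell2_at_top: "filterlim ell2 at_top sequentially"
  unfolding ell2_def by real_asymp

text \<open>The cutoff is the floor of \<open>n\<close> to the power \<open>1 / ell2 n\<close>: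
  small enough that Rankin's exponent can be as large as \<open>ell2 n / ln n\<close>, and large
  enough that its iterated logarithm is still \<open>ell2 n\<close> up to
  \<open>O(ln (ell2 n))\<close>.\<close>

definition trunc :: "nat \<Rightarrow> nat" where
  "trunc n = nat \<lfloor>exp (ln (real n) / ell2 n)\<rfloor>"

definition small_primes :: "nat \<Rightarrow> nat set" where
  "small_primes n = {p. prime p \<and> p \<le> trunc n}"

lemma finite_small_primes [simp]: "finite (small_primes n)"
  by (simp add: small_primes_def)

lemma sum_small_primes: "(\<Sum>p\<in>small_primes n. 1 / real p) = sum_inverse_primes (trunc n)"
  by (simp add: small_primes_def sum_inverse_primes_def)

lemma trunc_le_exp: "real (trunc n) \<le> exp (ln (real n) / ell2 n)"
  unfolding trunc_def by (simp add: of_nat_floor)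

text \<open>With \<open>x = ln n / ell2 n\<close> the cutoff lies between \<open>exp x / 2\<close>
  and \<open>exp x\<close>, and \<open>ln x = ell2 n - ln (ell2 n)\<close>. The threshold
  \<open>2 * ln 2 \<le> x\<close> serves twice: \<open>exp x \<ge> 4\<close> makes the cutoff at
  least 2, and \<open>x - ln 2 \<ge> x / 2\<close> limits the cost of the floor to
  \<open>ln 2\<close> after the second logarithm.\<close>

lemma eventually_trunc:
  "\<forall>\<^sub>F n in sequentially. 2 \<le> trunc n \<and> trunc n \<le> n
     \<and> ell2 n - ln (ell2 n) - ln 2 \<le> ln (ln (real (trunc n)))
     \<and> ln (ln (real (trunc n))) \<le> ell2 n - ln (ell2 n)"
proof -
  have "\<forall>\<^sub>F n in sequentially. 2 * ln 2 \<le> ln (real n) / ell2 n"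
    unfolding ell2_def by real_asymp
  moreover have "\<forall>\<^sub>F n in sequentially. 1 \<le> ell2 n"
    unfolding ell2_def by real_asymp
  moreover have "\<forall>\<^sub>F n in sequentially. 1 \<le> ln (real n)"
    by real_asymp
  ultimately show ?thesis using eventually_ge_at_top[of 1]
  proof eventually_elim
    case (elim n)
    define x where "x = ln (real n) / ell2 n"
    have x: "2 * ln 2 \<le> x" using elim by (simp add: x_def)
    have "4 = exp (2 * ln 2 :: real)" using exp_double[of "ln 2 :: real"] by simp
    also have "\<dots> \<le> exp x" using x by simp
    finally have x4: "4 \<le> exp x" .
    have eq: "real (trunc n) = of_int \<lfloor>exp x\<rfloor>" unfolding trunc_def x_def[symmetric] by simp
    have lower: "exp x / 2 \<le> real (trunc n)" using x4 unfolding eq by linarith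
    have upper: "real (trunc n) \<le> exp x" unfolding eq by linarith
    have two: "2 \<le> trunc n" using lower x4 by linarith
    have "x \<le> ln (real n)" using elim by (simp add: x_def divide_le_eq mult_le_cancel_left1)
    then have "exp x \<le> exp (ln (real n))" by simp
    also have "\<dots> = real n" using elim by simp
    finally have "trunc n \<le> n" using upper by linarith
    have lnx: "ln x = ell2 n - ln (ell2 n)"
      using elim unfolding x_def ell2_def[of n] by (subst ln_div) auto
    have "x - ln 2 = ln (exp x / 2)" by (simp add: ln_div)
    also have "\<dots> \<le> ln (real (trunc n))" using lower x4 by (subst ln_le_cancel_iff) auto
    finally have l1: "x / 2 \<le> ln (real (trunc n))" using x by linarith
    have x0: "0 < x" using x ln_gt_zero[of "2::real"] by linarith
    have "ln x - ln 2 = ln (x / 2)" using x0 by (simp add: ln_div)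
    also have "\<dots> \<le> ln (ln (real (trunc n)))"
      using l1 x0 by (subst ln_le_cancel_iff) linarith+
    finally have l2: "ln x - ln 2 \<le> ln (ln (real (trunc n)))" .
    have "ln (real (trunc n)) \<le> ln (exp x)"
      using upper two by (subst ln_le_cancel_iff) auto
    then have "ln (real (trunc n)) \<le> x" by simp
    then have "ln (ln (real (trunc n))) \<le> ln x"
      using l1 x0 by (subst ln_le_cancel_iff) linarith+
    then show ?case using two \<open>trunc n \<le> n\<close> l2 lnx by linarith
  qed
qed

text \<open>Mertens' second theorem at \<open>trunc n\<close> and at \<open>n\<close>. The first
  bound serves the centering, the second controls the mean number of omitted prime divisors.\<close>

lemma eventually_sum_small_primes:
  obtains C where "C \<ge> 0"
    "\<forall>\<^sub>F n in sequentially. \<bar>sum_inverse_primes (trunc n) - ell2 n\<bar> \<le> ln (ell2 n) + C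
       \<and> sum_inverse_primes n - sum_inverse_primes (trunc n) \<le> ln (ell2 n) + C"
proof -
  obtain C where C: "C \<ge> 0" "\<And>n. n \<ge> 2 \<Longrightarrow> \<bar>sum_inverse_primes n - ln (ln (real n))\<bar> \<le> C"
    using mertens_second by blast
  have "\<forall>\<^sub>F n in sequentially. 1 \<le> ell2 n"
    unfolding ell2_def by real_asymp
  then have "\<forall>\<^sub>F n in sequentially. \<bar>sum_inverse_primes (trunc n) - ell2 n\<bar> \<le> ln (ell2 n) + (2 * C + ln 2)
       \<and> sum_inverse_primes n - sum_inverse_primes (trunc n) \<le> ln (ell2 n) + (2 * C + ln 2)"
    using eventually_trunc
  proof eventually_elim
    case (elim n)
    have "0 \<le> ln (ell2 n)" "0 < ln (2::real)" using elim by auto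
    then show ?case
      using C(1) C(2)[of "trunc n"] C(2)[of n] elim unfolding ell2_def[of n] by linarith
  qed
  moreover have "0 \<le> 2 * C + ln 2" using C(1) by simp
  ultimately show ?thesis using that by blast
qed

lemma sum_small_primes_centered:
  "(\<lambda>n. (sum_inverse_primes (trunc n) - ell2 n) / sqrt (ell2 n)) \<longlonglongrightarrow> 0"
proof -
  obtain C where C: "C \<ge> 0"
    "\<forall>\<^sub>F n in sequentially. \<bar>sum_inverse_primes (trunc n) - ell2 n\<bar> \<le> ln (ell2 n) + C
       \<and> sum_inverse_primes n - sum_inverse_primes (trunc n) \<le> ln (ell2 n) + C"
    by (rule eventually_sum_small_primes)
  show ?thesis
  proof (rule Lim_null_comparison)
    show "\<forall>\<^sub>F n in sequentially. norm ((sum_inverse_primes (trunc n) - ell2 n) / sqrt (ell2 n))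
        \<le> (ln (ell2 n) + C) / sqrt (ell2 n)"
      using C(2) filterlim_at_top_dense[THEN iffD1, rule_format, OF ell2_at_top, of 0]
    proof eventually_elim
      case (elim n)
      then have "0 < sqrt (ell2 n)" by simp
      then show ?case unfolding real_norm_def abs_divide using elim
        by (simp add: divide_right_mono)
    qed
    have "((\<lambda>x. (ln x + C) / sqrt x) \<longlongrightarrow> 0) at_top" by real_asymp
    then show "(\<lambda>n. (ln (ell2 n) + C) / sqrt (ell2 n)) \<longlonglongrightarrow> 0"
      using ell2_at_top by (rule filterlim_compose)
  qed
qed

lemma sum_small_primes_ratio: "(\<lambda>n. sum_inverse_primes (trunc n) / ell2 n) \<longlonglongrightarrow> 1"
proof -
  have "((\<lambda>x. inverse (sqrt x)) \<longlongrightarrow> 0) at_top" by real_asymp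
  then have "(\<lambda>n. inverse (sqrt (ell2 n))) \<longlonglongrightarrow> 0"
    using ell2_at_top by (rule filterlim_compose)
  then have "(\<lambda>n. (sum_inverse_primes (trunc n) - ell2 n) / sqrt (ell2 n) * inverse (sqrt (ell2 n)) + 1) \<longlonglongrightarrow> 0 * 0 + 1"
    by (intro tendsto_intros sum_small_primes_centered)
  moreover have "\<forall>\<^sub>F n in sequentially.
      (sum_inverse_primes (trunc n) - ell2 n) / sqrt (ell2 n) * inverse (sqrt (ell2 n)) + 1
      = sum_inverse_primes (trunc n) / ell2 n"
    using filterlim_at_top_dense[THEN iffD1, rule_format, OF ell2_at_top, of 0]
  proof eventually_elim
    case (elim n)
    have "(sum_inverse_primes (trunc n) - ell2 n) / sqrt (ell2 n) * inverse (sqrt (ell2 n))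
      = (sum_inverse_primes (trunc n) - ell2 n) / (sqrt (ell2 n) * sqrt (ell2 n))"
      by (simp only: inverse_eq_divide times_divide_times_eq mult_1_right)
    also have "sqrt (ell2 n) * sqrt (ell2 n) = ell2 n" using elim by simp
    finally show ?case using elim by (simp add: diff_divide_distrib)
  qed
  ultimately show ?thesis by (simp cong: filterlim_cong add: tendsto_cong)
qed

section \<open>Comparison of the Euler product with an exponential\<close>

lemma norm_exp_minus_linear_le:
  fixes w :: complex
  assumes "cmod w \<le> 1"
  shows "cmod (exp w - (1 + w)) \<le> exp 1 * (cmod w)\<^sup>2"
proof -
  have "cmod (exp w - (1 + w)) \<le> exp (cmod w) * (cmod w)\<^sup>2"
    using Taylor_exp_field[of w 1] by (simp add: power2_eq_square)
  also have "\<dots> \<le> exp 1 * (cmod w)\<^sup>2" using assms by (intro mult_right_mono) auto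
  finally show ?thesis .
qed

text \<open>All factors of both products have modulus at most 1: \<open>1 + z / p\<close> is a
  convex combination of 1 and \<open>iexp u\<close>, and \<open>Re z \<le> 0\<close>. So the
  products differ by at most the sum of the differences of their factors, each of order
  \<open>u^2 / p^2\<close>.\<close>

lemma norm_prod_minus_exp_le:
  fixes u :: real and P :: "nat set"
  assumes P: "finite P" "\<And>p. p \<in> P \<Longrightarrow> p \<ge> 1" and u: "\<bar>u\<bar> \<le> 1"
  defines "z \<equiv> iexp u - 1"
  shows "cmod ((\<Prod>p\<in>P. 1 + z / of_nat p) - exp (z * of_real (\<Sum>p\<in>P. 1 / real p)))
    \<le> exp 1 * u\<^sup>2 * (\<Sum>k. 1 / real k ^ 2)"
proof -
  have zu: "cmod z \<le> \<bar>u\<bar>"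
    using iexp_approx1[of u 0] by (simp add: z_def)
  have Rez: "Re z \<le> 0" by (simp add: z_def Re_exp)
  have "exp (z * of_real (\<Sum>p\<in>P. 1 / real p)) = (\<Prod>p\<in>P. exp (z / of_nat p))"
    using P(1) by (simp add: exp_sum[symmetric] sum_distrib_left)
  also have "cmod ((\<Prod>p\<in>P. 1 + z / of_nat p) - \<dots>) \<le> (\<Sum>p\<in>P. cmod (1 + z / of_nat p - exp (z / of_nat p)))"
  proof (rule norm_prod_diff)
    fix p assume p: "p \<in> P"
    have p1: "real p \<ge> 1" using P(2)[OF p] by simp
    have "1 + z / of_nat p = of_real (1 - 1 / real p) + iexp u / of_nat p"
      by (simp add: z_def diff_divide_distrib)
    also have "cmod \<dots> \<le> cmod (of_real (1 - 1 / real p)) + cmod (iexp u / of_nat p)"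
      by (rule norm_triangle_ineq)
    also have "\<dots> = \<bar>1 - 1 / real p\<bar> + 1 / real p"
      unfolding norm_of_real by (simp add: norm_divide)
    also have "\<dots> = 1" using p1 by (simp add: field_simps)
    finally show "cmod (1 + z / of_nat p) \<le> 1" .
    have "Re (z / of_nat p) \<le> 0"
      using Rez p1 by (simp add: divide_le_0_iff)
    then show "cmod (exp (z / of_nat p)) \<le> 1" by simp
  qed
  also have "\<dots> \<le> (\<Sum>p\<in>P. exp 1 * u\<^sup>2 * (1 / real p ^ 2))"
  proof (rule sum_mono)
    fix p assume p: "p \<in> P"
    have p1: "real p \<ge> 1" using P(2)[OF p] by simp
    have "cmod (z / of_nat p) = cmod z / real p" by (simp add: norm_divide)
    also have "\<dots> \<le> \<bar>u\<bar> / real p" using zu by (intro divide_right_mono) auto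
    finally have w: "cmod (z / of_nat p) \<le> \<bar>u\<bar> / real p" .
    also have "\<dots> \<le> 1" using u p1 by (simp add: divide_le_eq)
    finally have "cmod (exp (z / of_nat p) - (1 + z / of_nat p)) \<le> exp 1 * (cmod (z / of_nat p))\<^sup>2"
      by (rule norm_exp_minus_linear_le)
    also have "\<dots> \<le> exp 1 * (\<bar>u\<bar> / real p)\<^sup>2"
      using w by (intro mult_left_mono power_mono) auto
    finally show "cmod (1 + z / of_nat p - exp (z / of_nat p)) \<le> exp 1 * u\<^sup>2 * (1 / real p ^ 2)"
      by (simp add: norm_minus_commute power_divide)
  qed
  also have "\<dots> = exp 1 * u\<^sup>2 * (\<Sum>p\<in>P. 1 / real p ^ 2)"
    by (simp only: sum_distrib_left)
  also have "\<dots> \<le> exp 1 * u\<^sup>2 * (\<Sum>k. 1 / real k ^ 2)"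
    using P(1) inverse_power_summable[of 2, where 'a = real]
    by (intro mult_left_mono sum_le_suminf) (auto simp: inverse_eq_divide)
  finally show ?thesis .
qed

section \<open>Characteristic function of the truncated count\<close>

definition normalized_count :: "nat \<Rightarrow> nat \<Rightarrow> real" where
  "normalized_count n m = (real (count_dividing (small_primes n) m) - ell2 n) / sqrt (ell2 n)"

lemma tendsto_compose_ell2:
  "((\<lambda>x. f x) \<longlongrightarrow> c) at_top \<Longrightarrow> (\<lambda>n. f (ell2 n)) \<longlonglongrightarrow> c"
  by (rule filterlim_compose[OF _ ell2_at_top])

text \<open>\<open>mean_power_count_dividing\<close> replaces the mean by the Euler product, and
  \<open>norm_prod_minus_exp_le\<close> replaces the product by the exponential; both are applied
  with \<open>z = iexp (u n) - 1\<close>, whose modulus is at most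
  \<open>\<bar>u n\<bar>\<close>.\<close>

lemma mean_iexp_minus_exp_tendsto_0:
  fixes t :: real
  defines "u \<equiv> \<lambda>n. t / sqrt (ell2 n)"
  shows "(\<lambda>n. (\<Sum>m=1..n. iexp (u n) ^ count_dividing (small_primes n) m) / of_nat n
      - exp ((iexp (u n) - 1) * of_real (sum_inverse_primes (trunc n)))) \<longlonglongrightarrow> 0"
proof (rule Lim_null_comparison)
  let ?S = "\<lambda>n. sum_inverse_primes (trunc n)"
  let ?B = "\<Sum>k. 1 / real k ^ 2"
  have u0: "u \<longlonglongrightarrow> 0"
    unfolding u_def by (rule tendsto_compose_ell2) real_asymp
  have "\<forall>\<^sub>F n in sequentially. \<bar>u n\<bar> < 1"
    using tendsto_rabs[OF u0] by (rule order_tendstoD) simp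
  moreover have "\<forall>\<^sub>F n in sequentially. 1 \<le> ell2 n"
    unfolding ell2_def by real_asymp
  moreover have "\<forall>\<^sub>F n in sequentially. 1 \<le> ln (real n)"
    by real_asymp
  ultimately show "\<forall>\<^sub>F n in sequentially. cmod ((\<Sum>m=1..n. iexp (u n) ^ count_dividing (small_primes n) m) / of_nat n
      - exp ((iexp (u n) - 1) * of_real (?S n)))
      \<le> 1 / real n + \<bar>u n\<bar> + exp (- ell2 n * (1 - exp 1 * \<bar>u n\<bar> * (?S n / ell2 n))) + exp 1 * (u n)\<^sup>2 * ?B"
    using eventually_ge_at_top[of 1]
  proof eventually_elim
    case (elim n)
    define z where "z = iexp (u n) - 1"
    \<comment> \<open>The largest exponent compatible with the cutoff: primes up to
      \<open>exp (ln n / ell2 n)\<close> satisfy \<open>p powr \<alpha> \<le> exp 1\<close>, while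
      Rankin's saving is \<open>n powr (-\<alpha>) = exp (- ell2 n)\<close>.\<close>
    define \<alpha> where "\<alpha> = ell2 n / ln (real n)"
    let ?P = "small_primes n"
    have zu: "cmod z \<le> \<bar>u n\<bar>"
      using iexp_approx1[of "u n" 0] by (simp add: z_def)
    have \<alpha>: "\<alpha> \<ge> 0" using elim by (simp add: \<alpha>_def)
    have \<alpha>ln: "\<alpha> * (ln (real n) / ell2 n) = 1" "\<alpha> * ln (real n) = ell2 n"
      using elim by (auto simp: \<alpha>_def)
    have S0: "0 \<le> ?S n" by (simp add: sum_inverse_primes_def sum_nonneg)
    have powr: "real p powr \<alpha> \<le> exp 1" if "p \<in> ?P" for p
    proof -
      have "real p \<le> exp (ln (real n) / ell2 n)"
        using that trunc_le_exp[of n] unfolding small_primes_def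
        by (smt (verit) mem_Collect_eq of_nat_le_iff)
      then have "real p powr \<alpha> \<le> exp (ln (real n) / ell2 n) powr \<alpha>"
        using \<alpha> by (intro powr_mono2) auto
      also have "\<dots> = exp (\<alpha> * (ln (real n) / ell2 n))"
        by (simp add: powr_def)
      finally show ?thesis unfolding \<alpha>ln .
    qed
    have "cmod ((\<Sum>m=1..n. (1 + z) ^ count_dividing ?P m) / n - (\<Prod>p\<in>?P. 1 + z / of_nat p))
      \<le> 1 / n + cmod z + real n powr (-\<alpha>) * exp (exp 1 * cmod z * (\<Sum>p\<in>?P. 1 / real p))"
      using zu elim \<alpha> powr
      by (intro mean_power_count_dividing) (auto simp: small_primes_def)
    also have "real n powr (-\<alpha>) = exp (- ell2 n)"
      using elim \<alpha>ln(2) by (simp add: powr_def)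
    also have "1 / n + cmod z + exp (- ell2 n) * exp (exp 1 * cmod z * (\<Sum>p\<in>?P. 1 / real p))
      \<le> 1 / n + \<bar>u n\<bar> + exp (- ell2 n) * exp (exp 1 * \<bar>u n\<bar> * ?S n)"
      unfolding sum_small_primes using zu S0
      by (intro add_mono mult_left_mono mult_right_mono order.refl)
         (auto intro!: mult_right_mono mult_left_mono)
    also have "exp (- ell2 n) * exp (exp 1 * \<bar>u n\<bar> * ?S n)
      = exp (- ell2 n * (1 - exp 1 * \<bar>u n\<bar> * (?S n / ell2 n)))"
      using elim by (simp add: exp_add[symmetric] algebra_simps)
    finally have 1: "cmod ((\<Sum>m=1..n. (1 + z) ^ count_dividing ?P m) / n - (\<Prod>p\<in>?P. 1 + z / of_nat p))
      \<le> 1 / n + \<bar>u n\<bar> + exp (- ell2 n * (1 - exp 1 * \<bar>u n\<bar> * (?S n / ell2 n)))" .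
    have 2: "cmod ((\<Prod>p\<in>?P. 1 + z / of_nat p) - exp (z * of_real (\<Sum>p\<in>?P. 1 / real p)))
      \<le> exp 1 * (u n)\<^sup>2 * ?B"
      unfolding z_def using elim prime_gt_0_nat
      by (intro norm_prod_minus_exp_le) (auto simp: small_primes_def Suc_le_eq)
    show ?case
      using norm_triangle_mono[OF 1 2] unfolding sum_small_primes z_def by simp
  qed
  have "((\<lambda>x::real. exp (-x)) \<longlongrightarrow> 0) at_top" by real_asymp
  \<comment> \<open>Since \<open>u\<close> tends to 0, the loss
    \<open>exp 1 * \<bar>u n\<bar> * ?S n\<close> is of smaller order than \<open>ell2 n\<close>, so
    the saving wins.\<close>
  have "(\<lambda>n. 1 - exp 1 * \<bar>u n\<bar> * (?S n / ell2 n)) \<longlonglongrightarrow> 1 - exp 1 * \<bar>0\<bar> * 1"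
    by (intro tendsto_intros u0 sum_small_primes_ratio)
  then have "(\<lambda>n. 1 - exp 1 * \<bar>u n\<bar> * (?S n / ell2 n)) \<longlonglongrightarrow> 1" by simp
  then have "filterlim (\<lambda>n. (1 - exp 1 * \<bar>u n\<bar> * (?S n / ell2 n)) * ell2 n) at_top sequentially"
    by (rule filterlim_tendsto_pos_mult_at_top) (auto intro: ell2_at_top)
  with \<open>((\<lambda>x::real. exp (-x)) \<longlongrightarrow> 0) at_top\<close>
  have "(\<lambda>n. exp (- ((1 - exp 1 * \<bar>u n\<bar> * (?S n / ell2 n)) * ell2 n))) \<longlonglongrightarrow> 0"
    by (rule filterlim_compose)
  then have main: "(\<lambda>n. exp (- ell2 n * (1 - exp 1 * \<bar>u n\<bar> * (?S n / ell2 n)))) \<longlonglongrightarrow> 0"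
    by (simp add: mult.commute)
  have "(\<lambda>n. 1 / real n + \<bar>u n\<bar> + exp (- ell2 n * (1 - exp 1 * \<bar>u n\<bar> * (?S n / ell2 n))) + exp 1 * (u n)\<^sup>2 * ?B)
    \<longlonglongrightarrow> 0 + \<bar>0\<bar> + 0 + exp 1 * 0\<^sup>2 * ?B"
    by (intro tendsto_intros u0 main lim_1_over_n)
  then show "(\<lambda>n. 1 / real n + \<bar>u n\<bar> + exp (- ell2 n * (1 - exp 1 * \<bar>u n\<bar> * (?S n / ell2 n))) + exp 1 * (u n)\<^sup>2 * ?B)
    \<longlonglongrightarrow> 0" by simp
qed

text \<open>Taylor expansion of \<open>iexp (u n) - 1\<close>, multiplied by the prime sum. The
  linear term minus the centering is \<open>t\<close> times a quantity tending to 0, the quadratic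
  term tends to \<open>t^2 / 2\<close>, and the cubic remainder \<open>r\<close> leaves order
  \<open>1 / sqrt (ell2 n)\<close>.\<close>

lemma centered_exp_tendsto:
  fixes t :: real
  defines "u \<equiv> \<lambda>n. t / sqrt (ell2 n)"
  shows "(\<lambda>n. exp ((iexp (u n) - 1) * of_real (sum_inverse_primes (trunc n))) * iexp (- (u n * ell2 n)))
    \<longlonglongrightarrow> of_real (exp (- (t\<^sup>2) / 2))"
proof -
  let ?S = "\<lambda>n. sum_inverse_primes (trunc n)"
  define r where "r n = iexp (u n) - 1 - \<i> * of_real (u n) + of_real ((u n)\<^sup>2 / 2)" for n
  have pos: "\<forall>\<^sub>F n in sequentially. 0 < ell2 n"
    using ell2_at_top by (simp add: filterlim_at_top_dense)
  have "(\<lambda>n. r n * of_real (?S n)) \<longlonglongrightarrow> 0"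
  proof (rule Lim_null_comparison)
    show "\<forall>\<^sub>F n in sequentially. cmod (r n * of_real (?S n)) \<le> \<bar>t\<bar> ^ 3 * inverse (sqrt (ell2 n)) * (?S n / ell2 n)"
      using pos
    proof eventually_elim
      case (elim n)
      have S0: "0 \<le> ?S n" by (simp add: sum_inverse_primes_def sum_nonneg)
      have "(\<Sum>k\<le>2. (\<i> * complex_of_real (u n))^k / fact k) = 1 + \<i> * of_real (u n) - of_real ((u n)\<^sup>2 / 2)"
        by (simp add: numeral_2_eq_2 power2_eq_square mult_ac)
      then have "r n = iexp (u n) - (\<Sum>k\<le>2. (\<i> * complex_of_real (u n))^k / fact k)"
        unfolding r_def by (simp only:) simp
      then have "cmod (r n) \<le> \<bar>u n\<bar> ^ Suc 2 / fact (Suc 2)"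
        using iexp_approx1[of "u n" 2] by (simp only:)
      also have "\<dots> \<le> \<bar>u n\<bar> ^ Suc 2 / 1" by (intro divide_left_mono fact_ge_1) simp_all
      also have "\<dots> = \<bar>u n\<bar> ^ 3" by simp
      also have "\<bar>u n\<bar> ^ 3 = \<bar>t\<bar> ^ 3 / (sqrt (ell2 n)) ^ 3"
        using elim by (simp add: u_def abs_divide power_divide)
      also have "(sqrt (ell2 n)) ^ 3 = sqrt (ell2 n) * ell2 n"
        using elim by (simp add: eval_nat_numeral)
      finally have "cmod (r n) * ?S n \<le> \<bar>t\<bar> ^ 3 / (sqrt (ell2 n) * ell2 n) * ?S n"
        using S0 by (rule mult_right_mono)
      then show ?case using S0 by (simp add: norm_mult divide_inverse mult_ac)
    qed
    have "(\<lambda>n. inverse (sqrt (ell2 n))) \<longlonglongrightarrow> 0"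
      by (rule tendsto_compose_ell2) real_asymp
    then have "(\<lambda>n. \<bar>t\<bar> ^ 3 * inverse (sqrt (ell2 n)) * (?S n / ell2 n)) \<longlonglongrightarrow> \<bar>t\<bar> ^ 3 * 0 * 1"
      by (intro tendsto_intros sum_small_primes_ratio)
    then show "(\<lambda>n. \<bar>t\<bar> ^ 3 * inverse (sqrt (ell2 n)) * (?S n / ell2 n)) \<longlonglongrightarrow> 0" by simp
  qed
  then have "(\<lambda>n. exp (r n * of_real (?S n) + \<i> * of_real (t * ((?S n - ell2 n) / sqrt (ell2 n)))
      - of_real (t\<^sup>2 / 2 * (?S n / ell2 n)))) \<longlonglongrightarrow> exp (0 + \<i> * of_real (t * 0) - of_real (t\<^sup>2 / 2 * 1))"
    by (intro tendsto_intros sum_small_primes_ratio sum_small_primes_centered)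
  also have "exp (0 + \<i> * of_real (t * 0) - of_real (t\<^sup>2 / 2 * 1)) = complex_of_real (exp (- (t\<^sup>2) / 2))"
    by (simp add: exp_of_real[symmetric])
  finally show ?thesis
  proof (rule Lim_transform_eventually)
    show "\<forall>\<^sub>F n in sequentially. exp (r n * of_real (?S n) + \<i> * of_real (t * ((?S n - ell2 n) / sqrt (ell2 n)))
      - of_real (t\<^sup>2 / 2 * (?S n / ell2 n)))
      = exp ((iexp (u n) - 1) * of_real (?S n)) * iexp (- (u n * ell2 n))"
      using pos
    proof eventually_elim
      case (elim n)
      have u2: "t\<^sup>2 / 2 * (?S n / ell2 n) = (u n)\<^sup>2 / 2 * ?S n"
        using elim by (simp add: u_def power_divide)
      have u1: "t * ((?S n - ell2 n) / sqrt (ell2 n)) = u n * ?S n - u n * ell2 n"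
        by (simp add: u_def right_diff_distrib diff_divide_distrib)
      show ?case unfolding exp_add[symmetric] u1 u2 r_def
        by (intro arg_cong[of _ _ exp]) (simp add: algebra_simps)
    qed
  qed
qed

text \<open>The normal law has a density, hence no atoms. Weak convergence gives convergence of
  distribution functions at continuity points, and \<open>slutsky\<close> also asks for
  continuity.\<close>

lemma isCont_cdf_std_normal: "isCont (cdf std_normal_distribution) x"
proof -
  interpret real_distribution std_normal_distribution by (rule real_dist_normal_dist)
  have "AE y in lborel. y \<noteq> x" by (rule AE_lborel_singleton)
  then have "emeasure std_normal_distribution {x} = 0"
    by (subst emeasure_density) (auto simp: nn_integral_0_iff_AE split: split_indicator)
  then show ?thesis by (simp add: isCont_cdf measure_def)
qed

text \<open>Levy's continuity theorem for the laws \<open>M n\<close>: their characteristic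
  functions are the means computed above times the centering factor
  \<open>iexp (- (u n * ell2 n))\<close>.\<close>

theorem erdos_kac_truncated:
  "(\<lambda>n. unif_prob n {m. normalized_count n m \<le> x}) \<longlonglongrightarrow> cdf std_normal_distribution x"
proof -
  define M where "M n = distr (measure_pmf (pmf_of_set {1..n})) borel (normalized_count n)" for n
  have "weak_conv_m M std_normal_distribution"
  proof (rule levy_continuity)
    show "real_distribution (M n)" for n
      unfolding M_def by (rule prob_space.real_distribution_distr[OF prob_space_measure_pmf]) simp
    show "real_distribution std_normal_distribution" by (rule real_dist_normal_dist)
    fix t :: real
    let ?u = "\<lambda>n. t / sqrt (ell2 n)" and ?S = "\<lambda>n. sum_inverse_primes (trunc n)"
    let ?E = "\<lambda>n. (\<Sum>m=1..n. iexp (?u n) ^ count_dividing (small_primes n) m) / of_nat n"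
    let ?X = "\<lambda>n. exp ((iexp (?u n) - 1) * of_real (?S n))"
    \<comment> \<open>The centering factor has modulus 1, so it preserves convergence to 0.\<close>
    have "(\<lambda>n. (?E n - ?X n) * iexp (- (?u n * ell2 n))) \<longlonglongrightarrow> 0"
      by (rule Lim_null_comparison[OF _ tendsto_norm_zero[OF mean_iexp_minus_exp_tendsto_0[of t]]])
         (simp add: norm_mult)
    then have "(\<lambda>n. (?E n - ?X n) * iexp (- (?u n * ell2 n)) + ?X n * iexp (- (?u n * ell2 n)))
        \<longlonglongrightarrow> 0 + of_real (exp (- (t\<^sup>2) / 2))"
      by (intro tendsto_add centered_exp_tendsto)
    then have "(\<lambda>n. ?E n * iexp (- (?u n * ell2 n))) \<longlonglongrightarrow> of_real (exp (- (t\<^sup>2) / 2))"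
      by (simp add: left_diff_distrib)
    moreover have "\<forall>\<^sub>F n in sequentially. ?E n * iexp (- (?u n * ell2 n)) = char (M n) t"
      using eventually_ge_at_top[of 1]
    proof eventually_elim
      case (elim n)
      have factor: "iexp (t * normalized_count n m)
          = iexp (?u n) ^ count_dividing (small_primes n) m * iexp (- (?u n * ell2 n))" for m
      proof -
        have "t * normalized_count n m = real (count_dividing (small_primes n) m) * ?u n + - (?u n * ell2 n)"
          by (simp add: normalized_count_def right_diff_distrib diff_divide_distrib)
        then have "\<i> * of_real (t * normalized_count n m)
            = of_nat (count_dividing (small_primes n) m) * (\<i> * of_real (?u n)) + \<i> * of_real (- (?u n * ell2 n))"
          by (simp only: of_real_add of_real_mult of_real_of_nat_eq distrib_left mult.left_commute)
        then show ?thesis by (simp only: exp_add exp_of_nat_mult)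
      qed
      have "char (M n) t = (\<integral>m. iexp (t * normalized_count n m) \<partial>measure_pmf (pmf_of_set {1..n}))"
        unfolding char_def M_def by (subst integral_distr) auto
      also have "\<dots> = (\<Sum>m\<in>{1..n}. pmf (pmf_of_set {1..n}) m *\<^sub>R iexp (t * normalized_count n m))"
        using elim by (intro integral_measure_pmf) auto
      also have "\<dots> = (\<Sum>m=1..n. iexp (?u n) ^ count_dividing (small_primes n) m * iexp (- (?u n * ell2 n)) / of_nat n)"
        unfolding factor using elim by (intro sum.cong refl) (simp add: scaleR_conv_of_real)
      also have "\<dots> = ?E n * iexp (- (?u n * ell2 n))"
        by (simp only: sum_distrib_right sum_divide_distrib times_divide_eq_left)
      finally show ?case by simp
    qed
    ultimately have "(\<lambda>n. char (M n) t) \<longlonglongrightarrow> of_real (exp (- (t\<^sup>2) / 2))"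
      by (rule Lim_transform_eventually)
    then show "(\<lambda>n. char (M n) t) \<longlonglongrightarrow> char std_normal_distribution t"
      by (simp add: char_std_normal_distribution)
  qed
  then have "(\<lambda>n. cdf (M n) x) \<longlonglongrightarrow> cdf std_normal_distribution x"
    using isCont_cdf_std_normal by (simp add: weak_conv_m_def weak_conv_def)
  moreover have "cdf (M n) x = unif_prob n {m. normalized_count n m \<le> x}" for n
    unfolding cdf_def M_def by (subst measure_distr) (auto simp: vimage_def)
  ultimately show ?thesis by simp
qed

subsection \<open>Convergence in probability\<close>

text \<open>Convergence in probability becomes ordinary convergence along the filter of those properties
  of pairs \<open>(n, m)\<close> whose probability under the uniform measure on \<open>m \<in> {1..n}\<close> tends to 1.\<close>
definition in_probability :: "(nat \<times> nat) filter" where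
  "in_probability = Abs_filter (\<lambda>P. (\<lambda>n. unif_prob n {m. P (n, m)}) \<longlonglongrightarrow> 1)"

lemma tendsto_1_squeeze_prob:
  assumes "f \<longlonglongrightarrow> 1" "\<And>n. f n \<le> unif_prob n (A n)"
  shows "(\<lambda>n. unif_prob n (A n)) \<longlonglongrightarrow> 1"
  by (rule tendsto_sandwich[OF _ _ assms(1) tendsto_const[of "1::real"]]) (use assms(2) in auto)

lemma unif_prob_Int_ge: "unif_prob n A + unif_prob n B - 1 \<le> unif_prob n (A \<inter> B)"
proof -
  have "unif_prob n (A \<union> B) = unif_prob n A + unif_prob n B - unif_prob n (A \<inter> B)"
    by (rule measure_Un3) (simp_all add: measure_pmf.fmeasurable_eq_sets)
  moreover have "unif_prob n (A \<union> B) \<le> 1" by simp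
  ultimately show ?thesis by linarith
qed

text \<open>These properties do form a filter: closure under conjunction is Bonferroni's inequality
  \<open>unif_prob_Int_ge\<close>, closure under weakening is monotonicity of the measure.\<close>

lemma eventually_in_probability:
  "eventually P in_probability \<longleftrightarrow> (\<lambda>n. unif_prob n {m. P (n, m)}) \<longlonglongrightarrow> 1"
  unfolding in_probability_def
proof (rule eventually_Abs_filter, unfold_locales)
  show "(\<lambda>n. unif_prob n {m. True}) \<longlonglongrightarrow> 1" by simp
next
  fix P Q :: "nat \<times> nat \<Rightarrow> bool"
  assume PQ: "(\<lambda>n. unif_prob n {m. P (n, m)}) \<longlonglongrightarrow> 1" "(\<lambda>n. unif_prob n {m. Q (n, m)}) \<longlonglongrightarrow> 1"
  have "(\<lambda>n. unif_prob n {m. P (n, m)} + unif_prob n {m. Q (n, m)} - 1) \<longlonglongrightarrow> 1 + 1 - 1"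
    by (intro tendsto_intros PQ)
  then show "(\<lambda>n. unif_prob n {m. P (n, m) \<and> Q (n, m)}) \<longlonglongrightarrow> 1"
    using unif_prob_Int_ge
    by (intro tendsto_1_squeeze_prob[of "\<lambda>n. unif_prob n {m. P (n, m)} + unif_prob n {m. Q (n, m)} - 1"])
       (auto simp: Collect_conj_eq)
next
  fix P Q :: "nat \<times> nat \<Rightarrow> bool"
  assume "\<forall>x. P x \<longrightarrow> Q x" "(\<lambda>n. unif_prob n {m. P (n, m)}) \<longlonglongrightarrow> 1"
  then show "(\<lambda>n. unif_prob n {m. Q (n, m)}) \<longlonglongrightarrow> 1"
    by (elim tendsto_1_squeeze_prob) (auto intro!: measure_pmf.finite_measure_mono)
qed

lemma eventually_in_probabilityI:
  assumes "f \<longlonglongrightarrow> 0" "\<forall>\<^sub>F n in sequentially. unif_prob n {m. \<not> P (n, m)} \<le> f n"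
  shows "eventually P in_probability"
  unfolding eventually_in_probability
proof (rule tendsto_sandwich)
  have "unif_prob n {m. P (n, m)} = 1 - unif_prob n {m. \<not> P (n, m)}" for n
    using measure_pmf.prob_compl[of "{m. \<not> P (n, m)}" "pmf_of_set {1..n}"]
    by (simp add: Compl_eq_Diff_UNIV[symmetric] Collect_neg_eq)
  then show "\<forall>\<^sub>F n in sequentially. 1 - f n \<le> unif_prob n {m. P (n, m)}"
    using assms(2) by (auto elim: eventually_mono)
  show "(\<lambda>n. 1 - f n) \<longlonglongrightarrow> 1" using tendsto_diff[OF tendsto_const[of 1] assms(1)] by simp
qed auto

lemma unif_prob_eq_card:
  assumes "n \<ge> 1"
  shows "unif_prob n A = real (card ({1..n} \<inter> A)) / real n"
  using assms by (subst measure_pmf_of_set) auto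

lemma eventually_in_probability_sequentially:
  assumes "eventually P sequentially"
  shows "\<forall>\<^sub>F q in in_probability. P (fst q)"
proof (rule eventually_in_probabilityI[OF tendsto_const])
  show "\<forall>\<^sub>F n in sequentially. unif_prob n {m. \<not> P (fst (n, m))} \<le> 0"
    using assms by eventually_elim simp
qed

lemma tendsto_in_probability_fst:
  assumes "filterlim f F sequentially"
  shows "filterlim (\<lambda>q. f (fst q)) F in_probability"
  using assms eventually_in_probability_sequentially unfolding filterlim_iff by fastforce

lemma eventually_in_probability_le: "\<forall>\<^sub>F q in in_probability. snd q \<in> {1..fst q}"
proof (rule eventually_in_probabilityI[OF tendsto_const])
  show "\<forall>\<^sub>F n in sequentially. unif_prob n {m. snd (n, m) \<notin> {1..fst (n, m)}} \<le> 0"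
    using eventually_ge_at_top[of 1]
  proof eventually_elim
    case (elim n)
    have "{1..n} \<inter> {m. snd (n, m) \<notin> {1..fst (n, m)}} = {}" by auto
    then show ?case unfolding unif_prob_eq_card[OF elim] by simp
  qed
qed

lemma eventually_in_probability_iff_prob:
  "(\<forall>\<^sub>F q in in_probability. snd q \<in> A (fst q)) \<longleftrightarrow> (\<lambda>n. unif_prob n (A n)) \<longlonglongrightarrow> 1"
  by (simp add: eventually_in_probability)

lemma conv_const_0_imp_tendsto:
  assumes "conv_const M h 0"
  shows "((\<lambda>q. h (snd q)) \<longlongrightarrow> 0) in_probability"
proof (rule tendstoI)
  fix e :: real assume "e > 0"
  \<comment> \<open>Halving turns the weak inequality of \<open>conv_const\<close> into the strict
    one of a limit.\<close>
  then have "(\<lambda>n. unif_prob n {m \<in> M n. \<bar>h m - 0\<bar> \<le> e / 2}) \<longlonglongrightarrow> 1"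
    using assms unfolding conv_const_def by (meson half_gt_zero)
  then have "\<forall>\<^sub>F q in in_probability. snd q \<in> {m \<in> M (fst q). \<bar>h m - 0\<bar> \<le> e / 2}"
    by (subst eventually_in_probability_iff_prob)
  then show "\<forall>\<^sub>F q in in_probability. dist (h (snd q)) 0 < e"
    by eventually_elim (use \<open>e > 0\<close> in auto)
qed

text \<open>Markov's inequality; nonnegativity is asked only on \<open>{1..n}\<close>, where the
  measure lives.\<close>

lemma markov_in_probability:
  assumes nonneg: "\<forall>\<^sub>F n in sequentially. \<forall>m\<in>{1..n}. 0 \<le> Y n m"
    and lim: "(\<lambda>n. (\<Sum>m=1..n. Y n m) / real n) \<longlonglongrightarrow> 0"
  shows "((\<lambda>q. Y (fst q) (snd q)) \<longlongrightarrow> (0::real)) in_probability"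
proof (rule tendstoI)
  fix e :: real assume e: "e > 0"
  have "\<forall>\<^sub>F q in in_probability. Y (fst q) (snd q) < e"
  proof (rule eventually_in_probabilityI)
    show "(\<lambda>n. (\<Sum>m=1..n. Y n m) / real n / e) \<longlonglongrightarrow> 0"
      using tendsto_divide[OF lim tendsto_const[of e]] e by simp
    show "\<forall>\<^sub>F n in sequentially. unif_prob n {m. \<not> Y (fst (n, m)) (snd (n, m)) < e} \<le> (\<Sum>m=1..n. Y n m) / real n / e"
      using nonneg eventually_ge_at_top[of 1]
    proof eventually_elim
      case (elim n)
      let ?B = "{1..n} \<inter> {m. \<not> Y n m < e}"
      have "e * real (card ?B) = (\<Sum>m\<in>?B. e)" by simp
      also have "\<dots> \<le> (\<Sum>m\<in>?B. Y n m)" by (intro sum_mono) auto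
      also have "\<dots> \<le> (\<Sum>m=1..n. Y n m)" using elim by (intro sum_mono2) auto
      finally have "real (card ?B) \<le> (\<Sum>m=1..n. Y n m) / e" using e by (simp add: field_simps)
      then have "real (card ?B) / real n \<le> (\<Sum>m=1..n. Y n m) / e / real n"
        by (rule divide_right_mono) simp
      then show ?case unfolding unif_prob_eq_card[OF elim(2)] by (simp add: mult.commute)
    qed
  qed
  moreover have "\<forall>\<^sub>F q in in_probability. 0 \<le> Y (fst q) (snd q)"
    using eventually_in_probability_sequentially[OF nonneg] eventually_in_probability_le
    by eventually_elim blast
  ultimately show "\<forall>\<^sub>F q in in_probability. dist (Y (fst q) (snd q)) 0 < e"
    by eventually_elim simp
qed

text \<open>A limit law makes \<open>X\<close> tight: outside an event of small probability
  \<open>\<bar>X\<bar> \<le> K\<close>, and there \<open>\<bar>Y\<bar> < e / K\<close>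
  suffices.\<close>

lemma tight_mult_tendsto_0:
  fixes X Y :: "nat \<Rightarrow> nat \<Rightarrow> real"
  assumes X: "\<And>x. (\<lambda>n. unif_prob n {m. X n m \<le> x}) \<longlonglongrightarrow> cdf N x"
    and N: "real_distribution N"
    and Y: "((\<lambda>q. Y (fst q) (snd q)) \<longlongrightarrow> 0) in_probability"
  shows "((\<lambda>q. X (fst q) (snd q) * Y (fst q) (snd q)) \<longlongrightarrow> 0) in_probability"
proof (rule tendstoI)
  interpret N: real_distribution N by fact
  fix e :: real assume e: "e > 0"
  let ?G = "\<lambda>n. {m. dist (X n m * Y n m) 0 < e}"
  have "(\<lambda>n. unif_prob n (?G n)) \<longlonglongrightarrow> 1"
  proof (rule order_tendstoI)
    fix a :: real assume a: "a < 1"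
    \<comment> \<open>Each of the two tails may take half of \<open>1 - a\<close>, so that more than
      \<open>a\<close> remains between \<open>- K\<close> and \<open>K\<close>.\<close>
    have "\<forall>\<^sub>F K in at_top. 1 - (1 - a) / 2 < cdf N K"
      using N.cdf_lim_at_top_prob a by (intro order_tendstoD(1)) auto
    moreover have "((\<lambda>K. cdf N (- K)) \<longlongrightarrow> 0) at_top"
      using N.cdf_lim_at_bot filterlim_uminus_at_bot_at_top by (rule filterlim_compose)
    then have "\<forall>\<^sub>F K in at_top. cdf N (- K) < (1 - a) / 2"
      using a by (intro order_tendstoD(2)) auto
    moreover have "\<forall>\<^sub>F K in at_top. K > (0::real)" by (rule eventually_gt_at_top)
    ultimately have "\<forall>\<^sub>F K in at_top. a < cdf N K - cdf N (- K) \<and> K > 0"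
    proof eventually_elim
      case (elim K)
      have "a < c - c'" if "1 - (1 - a) / 2 < c" "c' < (1 - a) / 2" for c c' :: real
        using that by (simp add: field_simps)
      with elim show ?case by blast
    qed
    then obtain K where K: "a < cdf N K - cdf N (- K)" "K > 0"
      using eventually_happens'[OF trivial_limit_at_top_linorder] by blast
    have "\<forall>\<^sub>F q in in_probability. dist (Y (fst q) (snd q)) 0 < e / K"
      using Y e K(2) by (intro tendstoD) auto
    then have Y1: "(\<lambda>n. unif_prob n {m. dist (Y n m) 0 < e / K}) \<longlonglongrightarrow> 1"
      by (simp add: eventually_in_probability)
    let ?f = "\<lambda>n. unif_prob n {m. X n m \<le> K} - unif_prob n {m. X n m \<le> - K}
        + unif_prob n {m. dist (Y n m) 0 < e / K} - 1"
    have "?f \<longlonglongrightarrow> cdf N K - cdf N (- K) + 1 - 1"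
      by (intro tendsto_intros X Y1)
    then have "\<forall>\<^sub>F n in sequentially. a < ?f n"
      using K(1) by (intro order_tendstoD(1)) auto
    moreover have "?f n \<le> unif_prob n (?G n)" for n
    proof -
      have "unif_prob n {m. X n m \<le> K} - unif_prob n {m. X n m \<le> - K}
        = unif_prob n ({m. X n m \<le> K} - {m. X n m \<le> - K})"
        using K(2) by (intro measure_pmf.finite_measure_Diff[symmetric]) auto
      then have "?f n \<le> unif_prob n (({m. X n m \<le> K} - {m. X n m \<le> - K}) \<inter> {m. dist (Y n m) 0 < e / K})"
        using unif_prob_Int_ge[of n "{m. X n m \<le> K} - {m. X n m \<le> - K}" "{m. dist (Y n m) 0 < e / K}"]
        by simp
      also have "\<dots> \<le> unif_prob n (?G n)"
      proof (rule measure_pmf.finite_measure_mono)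
        show "({m. X n m \<le> K} - {m. X n m \<le> - K}) \<inter> {m. dist (Y n m) 0 < e / K} \<subseteq> ?G n"
        proof
          fix m assume m: "m \<in> ({m. X n m \<le> K} - {m. X n m \<le> - K}) \<inter> {m. dist (Y n m) 0 < e / K}"
          then have "\<bar>X n m\<bar> \<le> K" "\<bar>Y n m\<bar> < e / K" by auto
          then have "\<bar>X n m\<bar> * \<bar>Y n m\<bar> \<le> K * \<bar>Y n m\<bar>" "K * \<bar>Y n m\<bar> < e"
            using K(2) by (simp_all add: mult_right_mono pos_less_divide_eq mult.commute)
          then have "\<bar>X n m\<bar> * \<bar>Y n m\<bar> < e" by (rule le_less_trans)
          then show "m \<in> ?G n" by (simp add: abs_mult)
        qed
      qed simp
      finally show ?thesis .
    qed
    ultimately show "\<forall>\<^sub>F n in sequentially. a < unif_prob n (?G n)"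
      by (auto elim!: eventually_mono intro: less_le_trans)
  next
    fix a :: real assume a: "1 < a"
    show "\<forall>\<^sub>F n in sequentially. unif_prob n (?G n) < a"
      by (intro always_eventually allI le_less_trans[OF _ a]) simp
  qed
  then show "\<forall>\<^sub>F q in in_probability. dist (X (fst q) (snd q) * Y (fst q) (snd q)) 0 < e"
    by (simp add: eventually_in_probability)
qed

text \<open>Up to an exceptional event, \<open>h \<le> x\<close> is implied by
  \<open>X \<le> x - d\<close> and implies \<open>X \<le> x + d\<close>. Continuity of
  \<open>F\<close> at \<open>x\<close> then lets \<open>d\<close> be chosen small.\<close>

lemma slutsky:
  fixes X h :: "nat \<Rightarrow> nat \<Rightarrow> real"
  assumes X: "\<And>x. (\<lambda>n. unif_prob n {m. X n m \<le> x}) \<longlonglongrightarrow> F x"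
    and F: "isCont F x"
    and M: "\<forall>\<^sub>F q in in_probability. snd q \<in> M (fst q)"
    and h: "((\<lambda>q. h (fst q) (snd q) - X (fst q) (snd q)) \<longlongrightarrow> 0) in_probability"
  shows "(\<lambda>n. unif_prob n {m \<in> M n. h n m \<le> x}) \<longlonglongrightarrow> F x"
proof -
  \<comment> \<open>The exceptional event also contains the points outside \<open>M n\<close>, so
    the restriction to the domain is treated together with the perturbation.\<close>
  define b where "b d n = unif_prob n {m. \<not> (m \<in> M n \<and> \<bar>h n m - X n m\<bar> < d)}" for d n
  have b: "b d \<longlonglongrightarrow> 0" if "d > 0" for d
  proof -
    have "\<forall>\<^sub>F q in in_probability. dist (h (fst q) (snd q) - X (fst q) (snd q)) 0 < d"
      using h that by (rule tendstoD)
    with M have "\<forall>\<^sub>F q in in_probability. snd q \<in> M (fst q) \<and> \<bar>h (fst q) (snd q) - X (fst q) (snd q)\<bar> < d"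
      by eventually_elim simp
    then have "(\<lambda>n. unif_prob n {m. m \<in> M n \<and> \<bar>h n m - X n m\<bar> < d}) \<longlonglongrightarrow> 1"
      by (simp add: eventually_in_probability)
    then have "(\<lambda>n. 1 - unif_prob n {m. m \<in> M n \<and> \<bar>h n m - X n m\<bar> < d}) \<longlonglongrightarrow> 1 - 1"
      by (intro tendsto_intros)
    moreover have eq: "b d n = 1 - unif_prob n {m. m \<in> M n \<and> \<bar>h n m - X n m\<bar> < d}" for n
      using measure_pmf.prob_compl[of "{m. m \<in> M n \<and> \<bar>h n m - X n m\<bar> < d}" "pmf_of_set {1..n}"]
      by (simp only: b_def Collect_neg_eq Compl_eq_Diff_UNIV) simp
    ultimately show ?thesis unfolding eq[abs_def] by (simp only: diff_self)
  qed
  have shift: "((\<lambda>d. x - d) \<longlongrightarrow> x) (at_right 0)" "((\<lambda>d. x + d) \<longlongrightarrow> x) (at_right 0)"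
    by (auto intro!: tendsto_eq_intros)
  have pos: "\<forall>\<^sub>F d in at_right 0. 0 < (d::real)"
    by (rule eventually_at_right_less)
  show ?thesis
  proof (rule order_tendstoI)
    fix a assume a: "a < F x"
    obtain d where d: "d > 0" "a < F (x - d)"
      using eventually_happens'[OF trivial_limit_at_right_real
        eventually_conj[OF pos order_tendstoD(1)[OF isCont_tendsto_compose[OF F shift(1)] a]]] by blast
    have "(\<lambda>n. unif_prob n {m. X n m \<le> x - d} - b d n) \<longlonglongrightarrow> F (x - d) - 0"
      by (intro tendsto_intros X b d)
    then have "\<forall>\<^sub>F n in sequentially. a < unif_prob n {m. X n m \<le> x - d} - b d n"
      using d(2) by (intro order_tendstoD(1)) auto
    moreover have "unif_prob n {m. X n m \<le> x - d} - b d n \<le> unif_prob n {m \<in> M n. h n m \<le> x}" for n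
    proof -
      have "unif_prob n {m. X n m \<le> x - d}
        \<le> unif_prob n ({m \<in> M n. h n m \<le> x} \<union> {m. \<not> (m \<in> M n \<and> \<bar>h n m - X n m\<bar> < d)})"
        by (intro measure_pmf.finite_measure_mono) auto
      also have "\<dots> \<le> unif_prob n {m \<in> M n. h n m \<le> x} + b d n"
        unfolding b_def by (intro measure_Un_le) auto
      finally show ?thesis by simp
    qed
    ultimately show "\<forall>\<^sub>F n in sequentially. a < unif_prob n {m \<in> M n. h n m \<le> x}"
      by (auto elim!: eventually_mono intro: less_le_trans)
  next
    fix a assume a: "F x < a"
    obtain d where d: "d > 0" "F (x + d) < a"
      using eventually_happens'[OF trivial_limit_at_right_real
        eventually_conj[OF pos order_tendstoD(2)[OF isCont_tendsto_compose[OF F shift(2)] a]]] by blast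
    have "(\<lambda>n. unif_prob n {m. X n m \<le> x + d} + b d n) \<longlonglongrightarrow> F (x + d) + 0"
      by (intro tendsto_intros X b d)
    then have "\<forall>\<^sub>F n in sequentially. unif_prob n {m. X n m \<le> x + d} + b d n < a"
      using d(2) by (intro order_tendstoD(2)) auto
    moreover have "unif_prob n {m \<in> M n. h n m \<le> x} \<le> unif_prob n {m. X n m \<le> x + d} + b d n" for n
    proof -
      have "unif_prob n {m \<in> M n. h n m \<le> x}
        \<le> unif_prob n ({m. X n m \<le> x + d} \<union> {m. \<not> (m \<in> M n \<and> \<bar>h n m - X n m\<bar> < d)})"
        by (intro measure_pmf.finite_measure_mono) auto
      also have "\<dots> \<le> unif_prob n {m. X n m \<le> x + d} + b d n"
        unfolding b_def by (intro measure_Un_le) auto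
      finally show ?thesis .
    qed
    ultimately show "\<forall>\<^sub>F n in sequentially. unif_prob n {m \<in> M n. h n m \<le> x} < a"
      by (auto elim!: eventually_mono intro: le_less_trans)
  qed
qed

subsection \<open>The prime divisor function under local adjustment\<close>

text \<open>For \<open>m \<ge> sqrt n\<close> one has \<open>ln n \<le> 2 * ln m\<close>, so the
  iterated logarithms differ by at most \<open>ln 2\<close>. At most \<open>sqrt n\<close> of the
  \<open>m\<close> fall below, a vanishing proportion.\<close>

lemma ell2_in_probability:
  "\<forall>\<^sub>F q in in_probability. ell2 (fst q) - ln 2 \<le> ell2 (snd q) \<and> ell2 (snd q) \<le> ell2 (fst q)"
proof -
  have "\<forall>\<^sub>F q in in_probability. fst q \<le> snd q * snd q"
  proof (rule eventually_in_probabilityI)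
    show "(\<lambda>n. sqrt (real n) / real n) \<longlonglongrightarrow> 0" by real_asymp
    show "\<forall>\<^sub>F n in sequentially. unif_prob n {m. \<not> fst (n, m) \<le> snd (n, m) * snd (n, m)} \<le> sqrt (real n) / real n"
      using eventually_ge_at_top[of 1]
    proof eventually_elim
      case (elim n)
      have "{1..n} \<inter> {m. \<not> fst (n, m) \<le> snd (n, m) * snd (n, m)} \<subseteq> {1..nat \<lfloor>sqrt (real n)\<rfloor>}"
      proof
        fix m assume m: "m \<in> {1..n} \<inter> {m. \<not> fst (n, m) \<le> snd (n, m) * snd (n, m)}"
        then have "real (m * m) \<le> real n" by (simp only: of_nat_le_iff) simp
        then have "(real m)\<^sup>2 \<le> real n" by (simp add: power2_eq_square)
        then have "real m \<le> sqrt (real n)" by (rule real_le_rsqrt)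
        then show "m \<in> {1..nat \<lfloor>sqrt (real n)\<rfloor>}" using m by (simp add: le_nat_floor)
      qed
      then have "card ({1..n} \<inter> {m. \<not> fst (n, m) \<le> snd (n, m) * snd (n, m)}) \<le> card {1..nat \<lfloor>sqrt (real n)\<rfloor>}"
        by (rule card_mono[rotated]) simp
      then have "real (card ({1..n} \<inter> {m. \<not> fst (n, m) \<le> snd (n, m) * snd (n, m)})) \<le> real (nat \<lfloor>sqrt (real n)\<rfloor>)"
        by (simp only: card_atLeastAtMost of_nat_le_iff diff_Suc_1)
      also have "\<dots> \<le> sqrt (real n)" by (simp add: of_nat_floor)
      finally show ?case unfolding unif_prob_eq_card[OF elim] by (rule divide_right_mono) simp
    qed
  qed
  moreover have "\<forall>\<^sub>F q in in_probability. 16 \<le> fst q"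
    by (intro eventually_in_probability_sequentially eventually_ge_at_top)
  ultimately show ?thesis using eventually_in_probability_le
  proof eventually_elim
    case (elim q)
    obtain n m where q: "q = (n, m)" by (cases q)
    have nm: "n \<le> m * m" "16 \<le> n" "m \<le> n" using elim by (auto simp: q)
    have m: "4 \<le> m"
    proof (rule ccontr)
      assume "\<not> 4 \<le> m"
      then have "m * m \<le> 3 * 3" by (intro mult_le_mono) auto
      then show False using nm by linarith
    qed
    have ln: "0 < ln (real m)" "ln (real m) \<le> ln (real n)" using m nm by auto
    have "real n \<le> real m * real m" using nm(1) by (metis of_nat_le_iff of_nat_mult)
    then have "ln (real n) \<le> ln (real m * real m)" using nm by (subst ln_le_cancel_iff) auto
    also have "\<dots> = 2 * ln (real m)" using m by (simp add: ln_mult)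
    finally have "ln (ln (real n)) \<le> ln (2 * ln (real m))"
      using ln by (subst ln_le_cancel_iff) linarith+
    also have "\<dots> = ln 2 + ln (ln (real m))" using ln by (simp add: ln_mult)
    finally have "ell2 n - ln 2 \<le> ell2 m" by (simp add: ell2_def)
    moreover have "ell2 m \<le> ell2 n" unfolding ell2_def using ln by (subst ln_le_cancel_iff) linarith+
    ultimately show ?case by (simp add: q)
  qed
qed

lemma omega_minus_count_small_primes:
  assumes "trunc n \<le> n" "m \<in> {1..n}"
  shows "real (omega m) - real (count_dividing (small_primes n) m)
    = real (count_dividing {p. prime p \<and> trunc n < p \<and> p \<le> n} m)"
proof -
  let ?A = "{p \<in> small_primes n. p dvd m}"
  let ?B = "{p \<in> {p. prime p \<and> trunc n < p \<and> p \<le> n}. p dvd m}"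
  have "prime_factors m = ?A \<union> ?B"
    using assms by (auto simp: prime_factors_dvd small_primes_def dest: dvd_imp_le)
  moreover have "finite ?A" by simp
  moreover have "finite ?B" by (rule finite_subset[of _ "{..n}"]) auto
  moreover have "?A \<inter> ?B = {}" by (auto simp: small_primes_def)
  ultimately have "omega m = card ?A + card ?B"
    unfolding omega_def by (simp only: card_Un_disjoint)
  then show ?thesis by (simp only: count_dividing_def)
qed

lemma sum_count_dividing_le:
  fixes P :: "nat set"
  assumes "finite P" "\<And>p. p \<in> P \<Longrightarrow> p > 0"
  shows "(\<Sum>m=1..n. real (count_dividing P m)) \<le> real n * (\<Sum>p\<in>P. 1 / real p)"
proof -
  have "(\<Sum>m=1..n. real (count_dividing P m)) = (\<Sum>m=1..n. \<Sum>p\<in>P. if p dvd m then 1 else 0)"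
    using assms(1) by (intro sum.cong[OF refl]) (simp add: count_dividing_def sum.If_cases Int_def)
  also have "\<dots> = (\<Sum>p\<in>P. \<Sum>m=1..n. if p dvd m then 1 else 0)" by (rule sum.swap)
  also have "\<dots> = (\<Sum>p\<in>P. real (n div p))"
  proof (rule sum.cong[OF refl])
    fix p assume "p \<in> P"
    then show "(\<Sum>m=1..n. if p dvd m then 1 else 0) = real (n div p)"
      using card_dvd_atLeastAtMost[OF assms(2)[of p], of n] by (simp add: sum.If_cases Int_def)
  qed
  also have "\<dots> \<le> (\<Sum>p\<in>P. real n / real p)" by (intro sum_mono real_div_le)
  also have "\<dots> = real n * (\<Sum>p\<in>P. 1 / real p)" by (simp add: sum_distrib_left)
  finally show ?thesis .
qed

text \<open>By Markov's inequality the mean decides. It is at most the sum of \<open>1 / p\<close>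
  over \<open>trunc n < p \<le> n\<close>, which is at most \<open>ln (ell2 n) + C\<close>, divided
  by \<open>sqrt (ell2 n)\<close>.\<close>

lemma omega_minus_count_in_probability:
  "((\<lambda>q. (real (omega (snd q)) - real (count_dividing (small_primes (fst q)) (snd q))) / sqrt (ell2 (fst q)))
     \<longlongrightarrow> 0) in_probability"
proof (rule markov_in_probability[where Y = "\<lambda>n m. (real (omega m) - real (count_dividing (small_primes n) m)) / sqrt (ell2 n)"])
  let ?Y = "\<lambda>n m. (real (omega m) - real (count_dividing (small_primes n) m)) / sqrt (ell2 n)"
  have pos: "\<forall>\<^sub>F n in sequentially. 0 < ell2 n"
    using ell2_at_top by (simp add: filterlim_at_top_dense)
  show nn: "\<forall>\<^sub>F n in sequentially. \<forall>m\<in>{1..n}. 0 \<le> ?Y n m"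
    using eventually_trunc pos
  proof eventually_elim
    case (elim n)
    show ?case
    proof
      fix m assume "m \<in> {1..n}"
      then show "0 \<le> ?Y n m"
        using elim omega_minus_count_small_primes[of n m] by simp
    qed
  qed
  obtain C where C: "C \<ge> 0"
    "\<forall>\<^sub>F n in sequentially. \<bar>sum_inverse_primes (trunc n) - ell2 n\<bar> \<le> ln (ell2 n) + C
       \<and> sum_inverse_primes n - sum_inverse_primes (trunc n) \<le> ln (ell2 n) + C"
    by (rule eventually_sum_small_primes)
  show "(\<lambda>n. (\<Sum>m=1..n. ?Y n m) / real n) \<longlonglongrightarrow> 0"
  proof (rule tendsto_sandwich)
    show "\<forall>\<^sub>F n in sequentially. 0 \<le> (\<Sum>m=1..n. ?Y n m) / real n"
      using nn
    proof eventually_elim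
      case (elim n)
      then have "0 \<le> (\<Sum>m=1..n. ?Y n m)" by (intro sum_nonneg) blast
      then show ?case by (rule divide_nonneg_nonneg) simp
    qed
    show "\<forall>\<^sub>F n in sequentially. (\<Sum>m=1..n. ?Y n m) / real n \<le> (ln (ell2 n) + C) / sqrt (ell2 n)"
      using eventually_trunc pos C(2) eventually_ge_at_top[of 1]
    proof eventually_elim
      case (elim n)
      define P where "P = {p. prime p \<and> trunc n < p \<and> p \<le> n}"
      have fin: "finite P" unfolding P_def by (rule finite_subset[of _ "{..n}"]) auto
      have "sum_inverse_primes n = sum_inverse_primes (trunc n) + (\<Sum>p\<in>P. 1 / real p)"
        unfolding sum_inverse_primes_def using elim(1) fin
        by (subst sum.union_disjoint[symmetric]) (auto simp: P_def intro!: sum.cong)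
      then have S: "(\<Sum>p\<in>P. 1 / real p) \<le> ln (ell2 n) + C" using elim(3) by linarith
      have "(\<Sum>m=1..n. ?Y n m) = (\<Sum>m=1..n. real (count_dividing P m) / sqrt (ell2 n))"
        unfolding P_def using elim(1) by (intro sum.cong[OF refl]) (simp only: omega_minus_count_small_primes)
      also have "\<dots> = (\<Sum>m=1..n. real (count_dividing P m)) / sqrt (ell2 n)"
        by (simp only: sum_divide_distrib)
      also have "\<dots> \<le> (real n * (ln (ell2 n) + C)) / sqrt (ell2 n)"
      proof (rule divide_right_mono)
        have "(\<Sum>m=1..n. real (count_dividing P m)) \<le> real n * (\<Sum>p\<in>P. 1 / real p)"
          by (rule sum_count_dividing_le[OF fin]) (auto simp: P_def)
        also have "\<dots> \<le> real n * (ln (ell2 n) + C)" using S by (rule mult_left_mono) simp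
        finally show "(\<Sum>m=1..n. real (count_dividing P m)) \<le> real n * (ln (ell2 n) + C)" .
      qed (use elim in simp)
      finally have "(\<Sum>m=1..n. ?Y n m) / real n \<le> (real n * (ln (ell2 n) + C)) / sqrt (ell2 n) / real n"
        by (rule divide_right_mono) simp
      also have "\<dots> = (ln (ell2 n) + C) / sqrt (ell2 n)" using elim(4) by simp
      finally show ?case .
    qed
    show "(\<lambda>n. (ln (ell2 n) + C) / sqrt (ell2 n)) \<longlonglongrightarrow> 0"
      by (rule tendsto_compose_ell2[of "\<lambda>x. (ln x + C) / sqrt x"]) real_asymp
  qed simp
qed

lemma full_domains_iff:
  "full_domains M \<longleftrightarrow> (\<forall>\<^sub>F n in sequentially. M n \<subseteq> {1..n})
     \<and> (\<forall>\<^sub>F q in in_probability. snd q \<in> M (fst q))"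
  unfolding full_domains_def eventually_in_probability_iff_prob ..

theorem theorem5:
  fixes M_mu M_sigma :: "nat \<Rightarrow> nat set"
    and f_mu f_sigma :: "nat \<Rightarrow> real"
    and g :: "real \<Rightarrow> real" and D :: "real set" and \<delta> :: real
  assumes "full_domains M_mu"
    and "full_domains M_sigma"
    and "little_o_pp (\<lambda>n. {m \<in> M_mu n. 3 \<le> m})
           (\<lambda>m. f_mu m - ell2 m) (\<lambda>m. sqrt (ell2 m))"
    and "little_o_pp (\<lambda>n. {m \<in> M_sigma n. 3 \<le> m})
           (\<lambda>m. f_sigma m - sqrt (ell2 m)) (\<lambda>m. sqrt (ell2 m))"
    and "0 < \<delta>"
    and "{1 - \<delta>..1 + \<delta>} \<subseteq> D"
    and "g differentiable (at 1)"
    and "deriv g 1 \<noteq> 0"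
  shows "conv_std_normal
           (\<lambda>n. {m \<in> M_mu n \<inter> M_sigma n.
                  f_mu m \<noteq> 0 \<and> f_sigma m \<noteq> 0 \<and> real (omega m) / f_mu m \<in> D})
           (\<lambda>m. (g (real (omega m) / f_mu m) - g 1) / (deriv g 1 * f_sigma m / f_mu m))"
proof -
  note o_mu = assms(3)[unfolded little_o_pp_def, THEN conv_const_0_imp_tendsto]
  note o_sigma = assms(4)[unfolded little_o_pp_def, THEN conv_const_0_imp_tendsto]
  \<comment> \<open>Both normalizations refer to \<open>n = fst q\<close>, as in the limit law for
    \<open>X\<close>; the adjustment functions, given relative to \<open>ell2 m\<close>, are first
    transferred to this scale.\<close>
  define s where "s q = sqrt (ell2 (fst q))" for q :: "nat \<times> nat"
  define X where "X q = normalized_count (fst q) (snd q)" for q :: "nat \<times> nat"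
  have L: "filterlim (\<lambda>q. ell2 (fst q)) at_top in_probability"
    by (rule tendsto_in_probability_fst[OF ell2_at_top])
  have s_top: "filterlim s at_top in_probability"
    unfolding s_def by (rule filterlim_compose[OF sqrt_at_top L])
  have inv_s: "((\<lambda>q. inverse (s q)) \<longlongrightarrow> 0) in_probability"
    using s_top by (rule tendsto_inverse_0_at_top)
  have pos: "\<forall>\<^sub>F q in in_probability. 0 < s q \<and> 0 < ell2 (snd q)"
  proof -
    have "\<forall>\<^sub>F q in in_probability. ln 2 < ell2 (fst q)"
      using L by (simp add: filterlim_at_top_dense)
    then show ?thesis using ell2_in_probability
    proof eventually_elim
      case (elim q)
      have "0 < ln (2::real)" by simp
      then have "0 < ell2 (fst q)" "0 < ell2 (snd q)" using elim by linarith+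
      then show ?case by (simp add: s_def)
    qed
  qed
  have ell2_diff: "((\<lambda>q. (ell2 (snd q) - ell2 (fst q)) / s q) \<longlongrightarrow> 0) in_probability"
  proof (rule Lim_null_comparison)
    show "\<forall>\<^sub>F q in in_probability. norm ((ell2 (snd q) - ell2 (fst q)) / s q) \<le> ln 2 * inverse (s q)"
      using ell2_in_probability pos
    proof eventually_elim
      case (elim q)
      have "\<bar>ell2 (snd q) - ell2 (fst q)\<bar> \<le> ln 2" using elim by linarith
      then have "\<bar>ell2 (snd q) - ell2 (fst q)\<bar> * inverse (s q) \<le> ln 2 * inverse (s q)"
        using elim by (intro mult_right_mono) auto
      then show ?case using elim by (simp add: abs_mult divide_inverse)
    qed
    show "((\<lambda>q. ln 2 * inverse (s q)) \<longlongrightarrow> 0) in_probability"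
      using tendsto_mult[OF tendsto_const inv_s] by simp
  qed
  have sqrt_ratio: "((\<lambda>q. sqrt (ell2 (snd q)) / s q) \<longlongrightarrow> 1) in_probability"
  proof -
    \<comment> \<open>As \<open>s^2 = ell2 n\<close>, the ratio \<open>ell2 m / ell2 n\<close> is 1
      plus the difference divided twice by \<open>s\<close>. The ratio \<open>f_mu / ell2 n\<close>
      is treated in the same way below.\<close>
    have "((\<lambda>q. sqrt ((ell2 (snd q) - ell2 (fst q)) / s q * inverse (s q) + 1)) \<longlongrightarrow> sqrt (0 * 0 + 1)) in_probability"
      by (intro tendsto_intros ell2_diff inv_s)
    then have "((\<lambda>q. sqrt ((ell2 (snd q) - ell2 (fst q)) / s q * inverse (s q) + 1)) \<longlongrightarrow> 1) in_probability"
      by simp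
    then show ?thesis
    proof (rule Lim_transform_eventually)
      show "\<forall>\<^sub>F q in in_probability. sqrt ((ell2 (snd q) - ell2 (fst q)) / s q * inverse (s q) + 1)
          = sqrt (ell2 (snd q)) / s q"
        using pos
      proof eventually_elim
        case (elim q)
        have ss: "s q * s q = ell2 (fst q)" and "ell2 (fst q) > 0" using elim by (auto simp: s_def)
        have "(ell2 (snd q) - ell2 (fst q)) / s q * inverse (s q) = (ell2 (snd q) - ell2 (fst q)) / ell2 (fst q)"
          by (simp only: inverse_eq_divide times_divide_times_eq mult_1_right ss)
        also have "\<dots> + 1 = ell2 (snd q) / ell2 (fst q)"
          using \<open>ell2 (fst q) > 0\<close> by (simp add: diff_divide_distrib)
        finally show ?case by (simp add: real_sqrt_divide s_def)
      qed
    qed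
  qed
  have sigma: "((\<lambda>q. f_sigma (snd q) / s q) \<longlongrightarrow> 1) in_probability"
  proof -
    have "((\<lambda>q. ((f_sigma (snd q) - sqrt (ell2 (snd q))) / sqrt (ell2 (snd q)) + 1) * (sqrt (ell2 (snd q)) / s q))
        \<longlongrightarrow> (0 + 1) * 1) in_probability"
      by (intro tendsto_intros o_sigma sqrt_ratio)
    then show ?thesis unfolding add_0 mult_1
    proof (rule Lim_transform_eventually)
      show "\<forall>\<^sub>F q in in_probability. ((f_sigma (snd q) - sqrt (ell2 (snd q))) / sqrt (ell2 (snd q)) + 1)
          * (sqrt (ell2 (snd q)) / s q) = f_sigma (snd q) / s q"
        using pos by eventually_elim (simp add: diff_divide_distrib)
    qed
  qed
  have mu: "((\<lambda>q. (f_mu (snd q) - ell2 (fst q)) / s q) \<longlongrightarrow> 0) in_probability"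
  proof -
    have "((\<lambda>q. (f_mu (snd q) - ell2 (snd q)) / sqrt (ell2 (snd q)) * (sqrt (ell2 (snd q)) / s q)
        + (ell2 (snd q) - ell2 (fst q)) / s q) \<longlongrightarrow> 0 * 1 + 0) in_probability"
      by (intro tendsto_intros o_mu sqrt_ratio ell2_diff)
    then have "((\<lambda>q. (f_mu (snd q) - ell2 (snd q)) / sqrt (ell2 (snd q)) * (sqrt (ell2 (snd q)) / s q)
        + (ell2 (snd q) - ell2 (fst q)) / s q) \<longlongrightarrow> 0) in_probability" by simp
    then show ?thesis
    proof (rule Lim_transform_eventually)
      show "\<forall>\<^sub>F q in in_probability. (f_mu (snd q) - ell2 (snd q)) / sqrt (ell2 (snd q)) * (sqrt (ell2 (snd q)) / s q)
        + (ell2 (snd q) - ell2 (fst q)) / s q = (f_mu (snd q) - ell2 (fst q)) / s q"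
        using pos
      proof eventually_elim
        case (elim q)
        then have "(f_mu (snd q) - ell2 (snd q)) / sqrt (ell2 (snd q)) * (sqrt (ell2 (snd q)) / s q)
          = (f_mu (snd q) - ell2 (snd q)) / s q" by simp
        then show ?case by (simp add: diff_divide_distrib)
      qed
    qed
  qed
  have mu_ratio: "((\<lambda>q. f_mu (snd q) / ell2 (fst q)) \<longlongrightarrow> 1) in_probability"
  proof -
    have "((\<lambda>q. (f_mu (snd q) - ell2 (fst q)) / s q * inverse (s q) + 1) \<longlongrightarrow> 0 * 0 + 1) in_probability"
      by (intro tendsto_intros mu inv_s)
    then have "((\<lambda>q. (f_mu (snd q) - ell2 (fst q)) / s q * inverse (s q) + 1) \<longlongrightarrow> 1) in_probability"
      by simp
    then show ?thesis
    proof (rule Lim_transform_eventually)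
      show "\<forall>\<^sub>F q in in_probability. (f_mu (snd q) - ell2 (fst q)) / s q * inverse (s q) + 1
          = f_mu (snd q) / ell2 (fst q)"
        using pos
      proof eventually_elim
        case (elim q)
        have ss: "s q * s q = ell2 (fst q)" and "ell2 (fst q) > 0" using elim by (auto simp: s_def)
        have "(f_mu (snd q) - ell2 (fst q)) / s q * inverse (s q) = (f_mu (snd q) - ell2 (fst q)) / ell2 (fst q)"
          by (simp only: inverse_eq_divide times_divide_times_eq mult_1_right ss)
        then show ?case using \<open>ell2 (fst q) > 0\<close> by (simp add: diff_divide_distrib)
      qed
    qed
  qed
  have nonzero: "\<forall>\<^sub>F q in in_probability. f_mu (snd q) \<noteq> 0 \<and> f_sigma (snd q) \<noteq> 0"
  proof -
    have "\<forall>\<^sub>F q in in_probability. 0 < f_mu (snd q) / ell2 (fst q)"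
      by (rule order_tendstoD(1)[OF mu_ratio]) simp
    moreover have "\<forall>\<^sub>F q in in_probability. 0 < f_sigma (snd q) / s q"
      by (rule order_tendstoD(1)[OF sigma]) simp
    ultimately show ?thesis by eventually_elim auto
  qed
  \<comment> \<open>\<open>W\<close> collects both perturbations, the omitted primes and the
    replacement of \<open>ell2 n\<close> by \<open>f_mu\<close>, so that \<open>X + W\<close> is
    exactly \<open>(omega - f_mu) / s\<close>.\<close>
  define W where "W q = (real (omega (snd q)) - real (count_dividing (small_primes (fst q)) (snd q))) / s q
    - (f_mu (snd q) - ell2 (fst q)) / s q" for q
  have W: "(W \<longlongrightarrow> 0) in_probability"
    unfolding W_def using tendsto_diff[OF omega_minus_count_in_probability mu]
    by (simp add: s_def)
  have XW: "X q + W q = (real (omega (snd q)) - f_mu (snd q)) / s q" for q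
    by (simp add: X_def W_def normalized_count_def s_def diff_divide_distrib)
  have tight: "((\<lambda>q. X q * Y q) \<longlongrightarrow> 0) in_probability" if "(Y \<longlongrightarrow> 0) in_probability" for Y
    using tight_mult_tendsto_0[OF erdos_kac_truncated real_dist_normal_dist, where Y = "\<lambda>n m. Y (n, m)"] that
    unfolding X_def by simp
  have ratio: "((\<lambda>q. real (omega (snd q)) / f_mu (snd q)) \<longlongrightarrow> 1) in_probability"
  proof -
    \<comment> \<open>This factor is \<open>s / f_mu\<close>, written through quantities with known
      limits; times \<open>X + W\<close> it gives \<open>omega / f_mu - 1\<close>.\<close>
    have c: "((\<lambda>q. inverse (s q) / (f_mu (snd q) / ell2 (fst q))) \<longlongrightarrow> 0) in_probability"
      using tendsto_divide[OF inv_s mu_ratio] by simp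
    have "((\<lambda>q. X q * (inverse (s q) / (f_mu (snd q) / ell2 (fst q)))
        + W q * (inverse (s q) / (f_mu (snd q) / ell2 (fst q))) + 1) \<longlongrightarrow> 0 + 0 * 0 + 1) in_probability"
      by (intro tendsto_intros tight c W)
    then have "((\<lambda>q. X q * (inverse (s q) / (f_mu (snd q) / ell2 (fst q)))
        + W q * (inverse (s q) / (f_mu (snd q) / ell2 (fst q))) + 1) \<longlongrightarrow> 1) in_probability"
      by simp
    then show ?thesis
    proof (rule Lim_transform_eventually)
      show "\<forall>\<^sub>F q in in_probability. X q * (inverse (s q) / (f_mu (snd q) / ell2 (fst q)))
        + W q * (inverse (s q) / (f_mu (snd q) / ell2 (fst q))) + 1 = real (omega (snd q)) / f_mu (snd q)"
        using pos nonzero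
      proof eventually_elim
        case (elim q)
        have ss: "ell2 (fst q) = s q * s q" using elim by (simp add: s_def)
        have "inverse (s q) / (f_mu (snd q) / ell2 (fst q)) = s q / f_mu (snd q)"
          unfolding ss using elim by (simp add: field_simps)
        then have "X q * (inverse (s q) / (f_mu (snd q) / ell2 (fst q)))
          + W q * (inverse (s q) / (f_mu (snd q) / ell2 (fst q))) = (X q + W q) * (s q / f_mu (snd q))"
          by (simp only: distrib_right)
        also have "\<dots> = (real (omega (snd q)) - f_mu (snd q)) / f_mu (snd q)"
          unfolding XW using elim by simp
        finally show ?case using elim by (simp add: diff_divide_distrib)
      qed
    qed
  qed
  \<comment> \<open>The value 1 at \<open>y = 1\<close> makes \<open>H\<close> continuous there, so
    it may be composed with \<open>omega / f_mu\<close>, which can equal 1. It also makes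
    \<open>g y - g 1 = deriv g 1 * H y * (y - 1)\<close> hold for every \<open>y\<close>.\<close>
  define H where "H y = (if y = 1 then 1 else (g y - g 1) / (y - 1) / deriv g 1)" for y
  have "(g has_field_derivative deriv g 1) (at 1)"
    using assms(7) by (simp add: DERIV_deriv_iff_real_differentiable)
  then have "((\<lambda>y. (g y - g 1) / (y - 1) / deriv g 1) \<longlongrightarrow> deriv g 1 / deriv g 1) (at 1)"
    unfolding has_field_derivative_iff using assms(8) by (intro tendsto_divide tendsto_const)
  then have "((\<lambda>y. (g y - g 1) / (y - 1) / deriv g 1) \<longlongrightarrow> H 1) (at 1)"
    using assms(8) by (simp add: H_def)
  then have "(H \<longlongrightarrow> H 1) (at 1)"
    by (rule LIM_equal[THEN iffD1, rotated]) (simp add: H_def)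
  then have H: "((\<lambda>q. H (real (omega (snd q)) / f_mu (snd q))) \<longlongrightarrow> 1) in_probability"
    using isCont_tendsto_compose[of 1 H, OF _ ratio] by (simp add: isCont_def) (simp add: H_def)
  define R where "R q = H (real (omega (snd q)) / f_mu (snd q)) / (f_sigma (snd q) / s q)" for q
  have R: "(R \<longlongrightarrow> 1) in_probability"
    unfolding R_def using tendsto_divide[OF H sigma] by simp
  let ?M = "\<lambda>n. {m \<in> M_mu n \<inter> M_sigma n. f_mu m \<noteq> 0 \<and> f_sigma m \<noteq> 0 \<and> real (omega m) / f_mu m \<in> D}"
  let ?T = "\<lambda>m. (g (real (omega m) / f_mu m) - g 1) / (deriv g 1 * f_sigma m / f_mu m)"
  have T: "\<forall>\<^sub>F q in in_probability. ?T (snd q) = (X q + W q) * R q"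
    using pos nonzero
  proof eventually_elim
    case (elim q)
    define y where "y = real (omega (snd q)) / f_mu (snd q)"
    have g: "g y - g 1 = deriv g 1 * H y * (y - 1)" using assms(8) by (simp add: H_def)
    have y: "(y - 1) * f_mu (snd q) = real (omega (snd q)) - f_mu (snd q)"
      using elim by (simp add: y_def left_diff_distrib)
    have "?T (snd q) = H y * ((y - 1) * f_mu (snd q)) / f_sigma (snd q)"
      unfolding y_def[symmetric] g using assms(8) elim by (simp add: field_simps)
    also have "\<dots> = (X q + W q) * R q"
      unfolding y XW R_def y_def[symmetric] using elim by (simp add: field_simps)
    finally show ?case .
  qed
  have diff: "((\<lambda>q. ?T (snd q) - normalized_count (fst q) (snd q)) \<longlongrightarrow> 0) in_probability"
  proof -
    have R1: "((\<lambda>q. R q - 1) \<longlongrightarrow> 0) in_probability" using tendsto_diff[OF R tendsto_const[of 1]] by simp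
    \<comment> \<open>This is \<open>(X + W) * R - X\<close>. Since \<open>X\<close> is only tight
      and not convergent in probability, its term needs \<open>tight\<close>.\<close>
    have "((\<lambda>q. X q * (R q - 1) + W q * R q) \<longlongrightarrow> 0 + 0 * 1) in_probability"
      by (intro tendsto_intros tight R1 W R)
    then have "((\<lambda>q. X q * (R q - 1) + W q * R q) \<longlongrightarrow> 0) in_probability" by simp
    then show ?thesis
    proof (rule Lim_transform_eventually)
      show "\<forall>\<^sub>F q in in_probability. X q * (R q - 1) + W q * R q = ?T (snd q) - normalized_count (fst q) (snd q)"
        using T by eventually_elim (simp only: X_def[symmetric], simp add: algebra_simps)
    qed
  qed
  have dom: "\<forall>\<^sub>F q in in_probability. snd q \<in> ?M (fst q)"
  proof -
    have "\<forall>\<^sub>F q in in_probability. dist (real (omega (snd q)) / f_mu (snd q)) 1 < \<delta>"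
      using ratio assms(5) by (rule tendstoD)
    moreover have "\<forall>\<^sub>F q in in_probability. snd q \<in> M_mu (fst q)" "\<forall>\<^sub>F q in in_probability. snd q \<in> M_sigma (fst q)"
      using assms(1,2) by (simp_all add: full_domains_iff)
    ultimately show ?thesis using nonzero
    proof eventually_elim
      case (elim q)
      have "real (omega (snd q)) / f_mu (snd q) \<in> {1 - \<delta>..1 + \<delta>}"
        using elim(1) unfolding dist_real_def atLeastAtMost_iff by linarith
      then show ?case using elim assms(6) by blast
    qed
  qed
  have "\<forall>\<^sub>F n in sequentially. M_mu n \<subseteq> {1..n}" using assms(1) by (simp add: full_domains_def)
  then have "\<forall>\<^sub>F n in sequentially. ?M n \<subseteq> {1..n}" by eventually_elim blast
  with dom have "full_domains ?M" by (simp add: full_domains_iff)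
  moreover have "(\<lambda>n. unif_prob n {m \<in> ?M n. ?T m \<le> x}) \<longlonglongrightarrow> cdf std_normal_distribution x" for x
    using slutsky[OF erdos_kac_truncated isCont_cdf_std_normal dom diff] .
  ultimately show ?thesis unfolding conv_std_normal_def by blast
qed

end
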